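(* There are infinitely many impostors of writhe $2$.
   Context: Legendrian knots in $(\mathbb{R}^3,\ker(dz-y\,dx))$ are represented by front projections to the $(x,z)$-plane: generically there are no vertical tangencies but semicubical cusps instead, and at each crossing the strand of more negative slope $dz/dx$ passes over. Fronts are considered up to planar isotopy of fronts. The smooth resolution of a front is the smooth diagram obtained by smoothing all cusps. Normal rulings. Let $\mathcal{F}$ be a front whose crossings and cusps have distinct $x$-coordinates. A normal ruling of $\mathcal{F}$ is a subset of the crossings, called switches, such that: (i) performing the $0$-resolution at every switch (replacing the crossing by two non-crossing horizontal strands, one above the other) yields a link each of whose components is a front with exactly two cusps and no self-crossings; the planar disks bounded by these components are called ruling disks; (ii) the two strands of the $0$-resolution near each switch belong to different ruling disks; (iii) (normality) if $x_0$ is the $x$-coordinate of a switch, the two ruling disks adjacent to the switch are either disjoint or nested over a sufficiently small interval $(x_0-\epsilon,x_0+\epsilon)$. An impostor is a front projection $\mathcal{F}$ such that: (1) the knot represented by $\mathcal{F}$ is not the unknot; (2) $\mathcal{F}$ admits a unique normal ruling; (3) up to smooth RIII moves, there are no available crossing-decreasing smooth Reidemeister moves, i.e. no diagram obtained from the smooth resolution of $\mathcal{F}$ by a sequence of smooth RIII moves admits a crossing-decreasing smooth Reidemeister move. *)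

theory Defs
  imports Main
begin

section \<open>Sliced diagrams\<close>

text \<open>
  A generic curve in the plane whose crossings and vertical tangencies (or cusps) have distinct
  \<open>x\<close>-coordinates is determined, up to planar isotopy, by the word of these events read from left
  to right. Strands over a slice are numbered from below, starting with \<open>0\<close>. The letter
  \<open>(Birth, p)\<close> creates the strands \<open>p\<close> and \<open>p + 1\<close> (left cusp, or left vertical tangency),
  \<open>(Death, p)\<close> joins the strands \<open>p\<close> and \<open>p + 1\<close> (right cusp, or right vertical tangency), and
  \<open>(Cross c, p)\<close> is a transverse crossing of the strands \<open>p\<close> and \<open>p + 1\<close>. The decoration \<open>c\<close>
  is trivial for fronts and is the crossing information for smooth diagrams.
\<close>

datatype 'c piece = Birth | Death | Cross 'c

type_synonym 'c sliced = "('c piece \<times> nat) list"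

fun ins :: "'c piece \<Rightarrow> nat" where
  "ins Birth = 0" | "ins Death = 2" | "ins (Cross c) = 2"

fun outs :: "'c piece \<Rightarrow> nat" where
  "outs Birth = 2" | "outs Death = 0" | "outs (Cross c) = 2"

text \<open>Number of strands over slice \<open>t\<close>, the one preceding the letter \<open>w ! t\<close>.\<close>

fun strands :: "'c sliced \<Rightarrow> nat \<Rightarrow> nat" where
  "strands w 0 = 0"
| "strands w (Suc t) = strands w t + outs (fst (w ! t)) - ins (fst (w ! t))"

text \<open>Not every word describes a closed curve; those that do are the following.\<close>

definition closed_word :: "'c sliced \<Rightarrow> bool" where
  "closed_word w \<longleftrightarrow>
     (\<forall>t < length w. snd (w ! t) + ins (fst (w ! t)) \<le> strands w t) \<and> strands w (length w) = 0"

section \<open>Components\<close>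

text \<open>The point \<open>(t, j)\<close> is the \<open>j\<close>-th strand over slice \<open>t\<close>.\<close>

type_synonym point = "nat \<times> nat"

definition points :: "'c sliced \<Rightarrow> point set" where
  "points w = {(t, j). t \<le> length w \<and> j < strands w t}"

inductive through :: "'c sliced \<Rightarrow> point \<Rightarrow> point \<Rightarrow> bool" for w where
  below: "t < length w \<Longrightarrow> w ! t = (k, p) \<Longrightarrow> j < p \<Longrightarrow> through w (t, j) (Suc t, j)"
| above: "t < length w \<Longrightarrow> w ! t = (k, p) \<Longrightarrow> p + ins k + j < strands w t \<Longrightarrow>
    through w (t, p + ins k + j) (Suc t, p + outs k + j)"
| ascend: "t < length w \<Longrightarrow> w ! t = (Cross c, p) \<Longrightarrow> through w (t, p) (Suc t, Suc p)"
| descend: "t < length w \<Longrightarrow> w ! t = (Cross c, p) \<Longrightarrow> through w (t, Suc p) (Suc t, p)"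

inductive turn :: "'c sliced \<Rightarrow> point \<Rightarrow> point \<Rightarrow> bool" for w where
  birth: "t < length w \<Longrightarrow> w ! t = (Birth, p) \<Longrightarrow> turn w (Suc t, p) (Suc t, Suc p)"
| death: "t < length w \<Longrightarrow> w ! t = (Death, p) \<Longrightarrow> turn w (t, p) (t, Suc p)"

definition component :: "'c sliced \<Rightarrow> point \<Rightarrow> point set" where
  "component w P = {Q. equivclp (\<lambda>P Q. through w P Q \<or> turn w P Q) P Q}"

definition components :: "'c sliced \<Rightarrow> point set set" where
  "components w = component w ` points w"

definition knot_word :: "'c sliced \<Rightarrow> bool" where
  "knot_word w \<longleftrightarrow> closed_word w \<and> card (components w) = 1"

section \<open>Smooth diagrams\<close>

text \<open>The crossing information: the over-strand is the one descending, respectively ascending,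
  from left to right.\<close>

datatype over = Descending | Ascending

fun opposite :: "over \<Rightarrow> over" where
  "opposite Descending = Ascending" | "opposite Ascending = Descending"

type_synonym diagram = "over sliced"

text \<open>\<open>d P\<close> tells whether the strand at \<open>P\<close> is directed to the right; only the values on
  the points of the diagram matter.\<close>

definition orientation :: "'c sliced \<Rightarrow> (point \<Rightarrow> bool) \<Rightarrow> bool" where
  "orientation w d \<longleftrightarrow>
     (\<forall>P Q. through w P Q \<longrightarrow> d P = d Q) \<and> (\<forall>P Q. turn w P Q \<longrightarrow> d P \<noteq> d Q)"

text \<open>If the descending strand is over, the crossing is positive iff both strands point in the
  same horizontal direction.\<close>

definition crossing_sign :: "diagram \<Rightarrow> (point \<Rightarrow> bool) \<Rightarrow> nat \<Rightarrow> int" where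
  "crossing_sign D d t = (case D ! t of
     (Cross c, p) \<Rightarrow> (if (d (t, p) = d (t, Suc p)) = (c = Descending) then 1 else - 1)
   | _ \<Rightarrow> 0)"

text \<open>For a knot the choice of the orientation is irrelevant, since both orientations give the
  same signs.\<close>

definition writhe :: "diagram \<Rightarrow> int" where
  "writhe D = (\<Sum>t < length D. crossing_sign D (SOME d. orientation D d) t)"

section \<open>Moves\<close>

text \<open>A local rule \<open>R l r\<close> is applied to a factor of a word, between closed words.\<close>

definition in_context :: "('c sliced \<Rightarrow> 'c sliced \<Rightarrow> bool) \<Rightarrow> 'c sliced \<Rightarrow> 'c sliced \<Rightarrow> bool" where
  "in_context R D E \<longleftrightarrow> closed_word D \<and> closed_word E \<and>
     (\<exists>u v l r. R l r \<and> D = u @ l @ v \<and> E = u @ r @ v)"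

text \<open>Two consecutive events, one above the other, exchange the order of their
  \<open>x\<close>-coordinates.\<close>

inductive exchange :: "'c sliced \<Rightarrow> 'c sliced \<Rightarrow> bool" where
  "exchange [(a, i), (b, i + outs a + k)] [(b, i + ins a + k), (a, i)]"

text \<open>A generic planar isotopy of smooth diagrams changes the word by exchanges, by creation or
  cancellation of two vertical tangencies on a strand, and by moving a vertical tangency of a
  strand through a crossing with another strand.\<close>

inductive planar :: "diagram \<Rightarrow> diagram \<Rightarrow> bool" where
  exch: "exchange l r \<Longrightarrow> planar l r"
| zigzag1: "planar [(Birth, i), (Death, Suc i)] []"
| zigzag2: "planar [(Birth, Suc i), (Death, i)] []"
| slide_birth: "planar [(Birth, i), (Cross c, Suc i)] [(Birth, Suc i), (Cross (opposite c), i)]"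
| slide_death: "planar [(Cross c, Suc i), (Death, i)] [(Cross (opposite c), i), (Death, Suc i)]"

text \<open>Up to planar isotopy, every monogon, every bigon one of whose strands is over the other,
  and every triangle looks like one of the left-hand sides below (for the triangle, up to
  exchanging the two sides). \<open>RI\<close> and \<open>RII\<close> decrease the number of crossings.\<close>

inductive RI :: "diagram \<Rightarrow> diagram \<Rightarrow> bool" where
  "RI [(Birth, i), (Cross c, i)] [(Birth, i)]"

inductive RII :: "diagram \<Rightarrow> diagram \<Rightarrow> bool" where
  "RII [(Cross c, i), (Cross (opposite c), i)] []"

text \<open>The crossings \<open>a\<close>, \<open>b\<close>, \<open>c\<close> are those of the strands entering at heights
  \<open>i, i + 1\<close>, at \<open>i, i + 2\<close> and at \<open>i + 1, i + 2\<close>. The side condition says that the three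
  strands are linearly ordered by the relation of passing over.\<close>

inductive RIII :: "diagram \<Rightarrow> diagram \<Rightarrow> bool" where
  "(a = c \<Longrightarrow> b = a) \<Longrightarrow>
   RIII [(Cross a, i), (Cross b, Suc i), (Cross c, i)]
        [(Cross c, Suc i), (Cross b, i), (Cross a, Suc i)]"

definition same_knot :: "diagram \<Rightarrow> diagram \<Rightarrow> bool" where
  "same_knot = equivclp (in_context (\<lambda>l r. planar l r \<or> RI l r \<or> RII l r \<or> RIII l r))"

definition unknot :: "diagram \<Rightarrow> bool" where
  "unknot D \<longleftrightarrow> same_knot D [(Birth, 0), (Death, 0)]"

definition RIII_equivalent :: "diagram \<Rightarrow> diagram \<Rightarrow> bool" where
  "RIII_equivalent = equivclp (in_context (\<lambda>l r. planar l r \<or> RIII l r))"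

definition crossing_decreasing :: "diagram \<Rightarrow> diagram \<Rightarrow> bool" where
  "crossing_decreasing = in_context (\<lambda>l r. RI l r \<or> RII l r)"

section \<open>Fronts\<close>

type_synonym front = "unit sliced"

definition crossings :: "front \<Rightarrow> nat set" where
  "crossings F = {t. t < length F \<and> fst (F ! t) = Cross ()}"

text \<open>A planar isotopy of fronts creates no vertical tangencies and moves no cusp through
  another strand.\<close>

definition front_isotopic :: "front \<Rightarrow> front \<Rightarrow> bool" where
  "front_isotopic = equivclp (in_context exchange)"

text \<open>Smoothing the cusps; the strand of more negative slope is over.\<close>

definition smooth_resolution :: "front \<Rightarrow> diagram" where
  "smooth_resolution F = map (\<lambda>(k, p). (map_piece (\<lambda>_. Descending) k, p)) F"

subsection \<open>Normal rulings\<close>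

text \<open>The \<open>0\<close>-resolution of a crossing deletes its letter from the word.\<close>

definition resolve :: "front \<Rightarrow> nat set \<Rightarrow> front" where
  "resolve F S = nths F (- S)"

text \<open>The slice of \<open>resolve F S\<close> that contains the \<open>x\<close>-coordinate of the letter \<open>t \<in> S\<close>
  of \<open>F\<close>.\<close>

definition resolved_slice :: "front \<Rightarrow> nat set \<Rightarrow> nat \<Rightarrow> nat" where
  "resolved_slice F S t = length (resolve (take t F) S)"

definition cusps_on :: "front \<Rightarrow> point set \<Rightarrow> nat set" where
  "cusps_on R C = {u. u < length R \<and>
     (\<exists>q. R ! u = (Birth, q) \<and> (Suc u, q) \<in> C \<or> R ! u = (Death, q) \<and> (u, q) \<in> C)}"

definition self_crossings :: "front \<Rightarrow> point set \<Rightarrow> nat set" where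
  "self_crossings R C = {u. u < length R \<and>
     (\<exists>q. R ! u = (Cross (), q) \<and> (u, q) \<in> C \<and> (u, Suc q) \<in> C)}"

text \<open>The vertical slice over slice \<open>s\<close> of the disk bounded by \<open>C\<close>, recorded by the
  heights it contains. Its end points are heights of strands, so two such slices are disjoint or
  nested iff these sets are.\<close>

definition disk_slice :: "point set \<Rightarrow> nat \<Rightarrow> nat set" where
  "disk_slice C s = {j. \<exists>a b. (s, a) \<in> C \<and> (s, b) \<in> C \<and> a \<le> j \<and> j \<le> b}"

definition normal_ruling :: "front \<Rightarrow> nat set \<Rightarrow> bool" where
  "normal_ruling F S \<longleftrightarrow> S \<subseteq> crossings F \<and>
     (let R = resolve F S in
       (\<forall>C \<in> components R. card (cusps_on R C) = 2 \<and> self_crossings R C = {}) \<and>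
       (\<forall>t \<in> S.
         let s = resolved_slice F S t; p = snd (F ! t);
             A = component R (s, p); B = component R (s, Suc p);
             I = disk_slice A s; J = disk_slice B s
         in A \<noteq> B \<and> (I \<inter> J = {} \<or> I \<subseteq> J \<or> J \<subseteq> I)))"

subsection \<open>Impostors\<close>

definition impostor :: "front \<Rightarrow> bool" where
  "impostor F \<longleftrightarrow> knot_word F \<and>
     \<not> unknot (smooth_resolution F) \<and>
     (\<exists>!S. normal_ruling F S) \<and>
     (\<nexists>D E. RIII_equivalent (smooth_resolution F) D \<and> crossing_decreasing D E)"

end

theory Submission
  imports Defs
begin

text \<open>
  The fronts are connected sums of \<open>3 n + 1\<close> copies of an eight-crossing front of writhe \<open>2\<close> and
  \<open>2 n\<close> copies of a left-handed trefoil of writhe \<open>- 3\<close>. Front isotopies preserve the number of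
  crossings and cusps, so these fronts are pairwise non-isotopic.

  Each summand triples the number of Fox 3-colourings, so the knots are non-trivial. Planar
  isotopies and third Reidemeister moves transport labellings of the arcs by the edges of an
  oriented Gauss code that respect the passages through the crossings. The Gauss code of the two
  summands contains no monogon, no bigon with one strand over the other and no triangle with
  linearly ordered strands, so no diagram that carries such a labelling admits a third or a
  crossing-decreasing Reidemeister move. Finally, a normal ruling is the same as a sequence of
  choices along the front that keeps the labels of the strands by left cusps consistent; every summand is
  entered and left by two strands with a common label and admits just one such sequence.
\<close>

text \<open>Condition (3) of an impostor ranges over infinitely many words, because planar isotopies
  may create vertical tangencies between the triangle moves, so it cannot be settled by enumeration.
  It is settled by a state sum with values in \<open>nat\<close>: the number of labellings by the
  Gauss code is positive for the fronts, and zero for every word in which a monogon or a bigon can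
  be removed. Invariance under triangle moves then becomes vacuous: as the code has no ordered
  triangle, both sides of the Yang-Baxter equation are zero. The count of Fox colourings is another
  instance of the same state sum, so planar isotopies and contexts are treated only once. One finite
  code serves all \<open>n\<close>, because the single edge \<open>0\<close> represents every strand
  that joins blocks. Labellings need not be injective: any of them carries a monogon, bigon or
  triangle of the diagram to one of the code.\<close>

section \<open>Closed words by recursion on the word\<close>

fun valid :: "'c sliced \<Rightarrow> nat \<Rightarrow> bool" where
  "valid [] n \<longleftrightarrow> n = 0"
| "valid ((k, p) # w) n \<longleftrightarrow> p + ins k \<le> n \<and> valid w (n + outs k - ins k)"

text \<open>\<open>strands\<close> counts from the left end of a fixed word whereas
  \<open>valid\<close> consumes the word, so the induction runs over all splittings into a part
  already read and the rest.\<close>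

lemma valid_suffix:
  "valid v (strands (u @ v) (length u)) \<longleftrightarrow>
     (\<forall>t. length u \<le> t \<and> t < length (u @ v) \<longrightarrow>
        snd ((u @ v) ! t) + ins (fst ((u @ v) ! t)) \<le> strands (u @ v) t) \<and>
     strands (u @ v) (length (u @ v)) = 0"
proof (induction v arbitrary: u)
  case Nil
  then show ?case by auto
next
  case (Cons x v)
  obtain k p where x: "x = (k, p)" by fastforce
  have IH: "valid v (strands (u @ x # v) (Suc (length u))) \<longleftrightarrow>
     (\<forall>t. Suc (length u) \<le> t \<and> t < length (u @ x # v) \<longrightarrow>
        snd ((u @ x # v) ! t) + ins (fst ((u @ x # v) ! t)) \<le> strands (u @ x # v) t) \<and>
     strands (u @ x # v) (length (u @ x # v)) = 0"
    using Cons.IH[of "u @ [x]"] by simp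
  have split: "(\<forall>t. length u \<le> t \<and> t < length (u @ x # v) \<longrightarrow> Q t) \<longleftrightarrow>
      Q (length u) \<and> (\<forall>t. Suc (length u) \<le> t \<and> t < length (u @ x # v) \<longrightarrow> Q t)" for Q
    by (auto simp: le_less_Suc_eq not_less_eq_eq dest: le_antisym) (metis Suc_leI le_neq_implies_less)
  show ?case
    unfolding split using IH by (auto simp: x nth_append)
qed

lemma closed_word_iff_valid: "closed_word w \<longleftrightarrow> valid w 0"
  using valid_suffix[of w "[]"] by (auto simp: closed_word_def)

section \<open>State sums\<close>

lemma equivclp_invariant:
  assumes "equivclp r x y" "\<And>x y. r x y \<Longrightarrow> f x = f y"
  shows "f x = f y"
  using assms(1)
proof (induction rule: equivclp_induct)
  case (step y z)
  have "f y = f z"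
    using step(2) by (rule disjE) (erule assms(2), erule assms(2)[symmetric])
  then show ?case using step.IH by simp
qed simp

lemma opposite_opposite [simp]: "opposite (opposite c) = c"
  by (cases c) auto

lemma split_at: "i + m \<le> length s \<Longrightarrow> \<exists>r xs q. s = r @ xs @ q \<and> length r = i \<and> length xs = m"
  by (rule exI[of _ "take i s"], rule exI[of _ "take m (drop i s)"], rule exI[of _ "drop (i + m) s"])
     (simp, metis add.commute append_take_drop_id drop_drop)

lemma split1:
  assumes "Suc i \<le> length s" shows "\<exists>r x q. s = r @ x # q \<and> length r = i"
proof -
  obtain r xs q where "s = r @ xs @ q" "length r = i" "length xs = Suc 0"
    using split_at[of i "Suc 0" s] assms by auto
  moreover obtain x where "xs = [x]" using \<open>length xs = Suc 0\<close> by (auto simp: length_Suc_conv)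
  ultimately show ?thesis by auto
qed

lemma split3:
  assumes "Suc (Suc (Suc i)) \<le> length s" shows "\<exists>r x y z q. s = r @ x # y # z # q \<and> length r = i"
proof -
  obtain r xs q where "s = r @ xs @ q" "length r = i" "length xs = Suc (Suc (Suc 0))"
    using split_at[of i "Suc (Suc (Suc 0))" s] assms by auto
  moreover obtain x y z where "xs = [x, y, z]"
    using \<open>length xs = Suc (Suc (Suc 0))\<close> by (auto simp: length_Suc_conv)
  ultimately have "s = r @ x # y # z # q" by simp
  then show ?thesis using \<open>length r = i\<close> by blast
qed

text \<open>A colour is attached to a strand as seen from left to right, and \<open>flip\<close>
  changes it where the strand turns around. The relation \<open>C c x y\<close> is set-valued so
  that a crossing may have no admissible continuation. \<open>rotate\<close> is a quarter turn of a
  crossing: it exchanges ascending and descending strands and flips the two ends that change sides.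
  In \<open>yang_baxter\<close> the arbitrary \<open>f\<close> stands for the number of colourings
  of the rest of the word.\<close>

locale strand_colouring =
  fixes X :: "'x set" and flip :: "'x \<Rightarrow> 'x" and C :: "over \<Rightarrow> 'x \<Rightarrow> 'x \<Rightarrow> ('x \<times> 'x) set"
  assumes finite_X: "finite X"
    and flip_in: "x \<in> X \<Longrightarrow> flip x \<in> X"
    and flip_flip [simp]: "flip (flip x) = x"
    and C_in: "C c x y \<subseteq> X \<times> X"
    and rotate: "(a, b) \<in> C c x y \<longleftrightarrow> (flip x, a) \<in> C (opposite c) y (flip b)"
    and yang_baxter: "(c1 = c3 \<Longrightarrow> c2 = c1) \<Longrightarrow>
      (\<Sum>(x1, y1) \<in> C c1 x y. \<Sum>(y2, z1) \<in> C c2 y1 z. \<Sum>(x2, y3) \<in> C c3 x1 y2. f x2 y3 z1) =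
      (\<Sum>(y1, z1) \<in> C c3 y z. \<Sum>(x1, y2) \<in> C c2 x y1. \<Sum>(y3, z2) \<in> C c1 y2 z1. (f x1 y3 z2 :: nat))"
begin

definition replacements :: "over piece \<Rightarrow> 'x list \<Rightarrow> 'x list set" where
  "replacements k xs = (case k of
     Birth \<Rightarrow> (\<lambda>x. [x, flip x]) ` X
   | Death \<Rightarrow> (if xs ! 0 = flip (xs ! 1) then {[]} else {})
   | Cross c \<Rightarrow> (\<lambda>(a, b). [a, b]) ` C c (xs ! 0) (xs ! 1))"

fun colourings :: "diagram \<Rightarrow> 'x list \<Rightarrow> nat" where
  "colourings [] s = of_bool (s = [])"
| "colourings ((k, p) # w) s =
     (\<Sum>ys \<in> replacements k (take (ins k) (drop p s)).
        colourings w (take p s @ ys @ drop (p + ins k) s))"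

lemma finite_C: "finite (C c x y)"
  using C_in finite_X by (meson finite_SigmaI finite_subset)

lemma finite_replacements: "finite (replacements k xs)"
  by (auto simp: replacements_def finite_X finite_C split: piece.splits)

lemma replacements_in: "ys \<in> replacements k xs \<Longrightarrow> length ys = outs k \<and> set ys \<subseteq> X"
  using C_in flip_in by (fastforce simp: replacements_def split: piece.splits if_splits)

lemma colourings_append:
  "length r = p \<Longrightarrow> length xs = ins k \<Longrightarrow>
   colourings ((k, p) # w) (r @ xs @ s) = (\<Sum>ys \<in> replacements k xs. colourings w (r @ ys @ s))"
  by simp

declare colourings.simps(2) [simp del]

lemma colourings_birth:
  "length r = p \<Longrightarrow> colourings ((Birth, p) # w) (r @ s) =
     (\<Sum>x \<in> X. colourings w (r @ x # flip x # s))"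
proof -
  assume "length r = p"
  then have "colourings ((Birth, p) # w) (r @ [] @ s) =
      (\<Sum>ys \<in> (\<lambda>x. [x, flip x]) ` X. colourings w (r @ ys @ s))"
    by (subst colourings_append) (simp_all add: replacements_def)
  also have "\<dots> = (\<Sum>x \<in> X. colourings w (r @ x # flip x # s))"
    by (subst sum.reindex) (auto simp: inj_on_def)
  finally show ?thesis by simp
qed

lemma colourings_death:
  "length r = p \<Longrightarrow> colourings ((Death, p) # w) (r @ x # y # s) =
     (if x = flip y then colourings w (r @ s) else 0)"
  using colourings_append[of r p "[x, y]" Death w s] by (simp add: replacements_def)

lemma colourings_cross:
  "length r = p \<Longrightarrow> colourings ((Cross c, p) # w) (r @ x # y # s) =
     (\<Sum>(a, b) \<in> C c x y. colourings w (r @ a # b # s))"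
proof -
  assume "length r = p"
  then have "colourings ((Cross c, p) # w) (r @ [x, y] @ s) =
      (\<Sum>ys \<in> (\<lambda>(a, b). [a, b]) ` C c x y. colourings w (r @ ys @ s))"
    by (subst colourings_append) (simp_all add: replacements_def)
  also have "\<dots> = (\<Sum>(a, b) \<in> C c x y. colourings w (r @ a # b # s))"
    by (subst sum.reindex) (auto simp: inj_on_def intro!: sum.cong)
  finally show ?thesis by simp
qed

text \<open>The two letters act on disjoint segments of the state, so the statement is an
  interchange of two sums.\<close>

lemma colourings_exchange:
  assumes "exchange l r" "valid (l @ v) (length s)"
  shows "colourings (l @ v) s = colourings (r @ v) s"
  using assms(1)
proof cases
  case (1 a i b k)
  have *: "i + ins a + (k + ins b) \<le> length s"
    using assms(2) by (auto simp: 1)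
  obtain s1 xs q where s: "s = s1 @ xs @ q" "length s1 = i" "length xs = ins a"
    using split_at[of i "ins a" s] * by auto
  obtain s2 ys s3 where q: "q = s2 @ ys @ s3" "length s2 = k" "length ys = ins b"
    using split_at[of k "ins b" q] * s by auto
  have "colourings (l @ v) s =
      (\<Sum>xs' \<in> replacements a xs. colourings ((b, i + outs a + k) # v) (s1 @ xs' @ s2 @ ys @ s3))"
    using s q by (simp add: 1 colourings_append)
  also have "\<dots> = (\<Sum>xs' \<in> replacements a xs. \<Sum>ys' \<in> replacements b ys.
      colourings v (s1 @ xs' @ s2 @ ys' @ s3))"
  proof (rule sum.cong)
    fix xs' assume "xs' \<in> replacements a xs"
    then show "colourings ((b, i + outs a + k) # v) (s1 @ xs' @ s2 @ ys @ s3) =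
        (\<Sum>ys' \<in> replacements b ys. colourings v (s1 @ xs' @ s2 @ ys' @ s3))"
      using colourings_append[of "s1 @ xs' @ s2" "i + outs a + k" ys b v s3] replacements_in s q
      by simp
  qed simp
  also have "\<dots> = (\<Sum>ys' \<in> replacements b ys. \<Sum>xs' \<in> replacements a xs.
      colourings v (s1 @ xs' @ s2 @ ys' @ s3))"
    by (rule sum.swap)
  also have "\<dots> = (\<Sum>ys' \<in> replacements b ys. colourings ((a, i) # v) (s1 @ xs @ s2 @ ys' @ s3))"
    using s q by (simp add: colourings_append)
  also have "\<dots> = colourings (r @ v) s"
    using colourings_append[of "s1 @ xs @ s2" "i + ins a + k" ys b "(a, i) # v" s3] s q
    by (simp add: 1)
  finally show ?thesis .
qed

text \<open>For zigzags, the right tangency reduces the sum over all new colours to the one term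
  that continues the strand; this term occurs because the state has its colours in \<open>X\<close>.
  For slides, the two sums are matched term by term through \<open>rotate\<close>.\<close>

lemma colourings_planar:
  assumes "planar l r" "valid (l @ v) (length s)" "valid (r @ v) (length s)" "set s \<subseteq> X"
  shows "colourings (l @ v) s = colourings (r @ v) s"
  using assms(1)
proof cases
  case exch
  then show ?thesis using colourings_exchange assms by blast
next
  case (zigzag1 i)
  have "length s \<ge> Suc i" using assms(2) by (simp add: zigzag1)
  then obtain q x u where s: "s = q @ x # u" "length q = i" using split1 by blast
  have "colourings (l @ v) s = (\<Sum>y \<in> X. colourings ((Death, Suc i) # v) (q @ y # flip y # x # u))"
    by (simp add: zigzag1 s colourings_birth)
  also have "\<dots> = (\<Sum>y \<in> X. if y = x then colourings v (q @ y # u) else 0)"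
    using colourings_death[of "q @ [y]" "Suc i" v "flip y" x u for y] s
    by (intro sum.cong) (auto, metis flip_flip)
  also have "\<dots> = colourings v s"
    using assms(4) finite_X by (simp add: s)
  finally show ?thesis by (simp add: zigzag1)
next
  case (zigzag2 i)
  have "length s \<ge> Suc i" using assms(2) by (simp add: zigzag2)
  then obtain q x u where s: "s = q @ x # u" "length q = i" using split1 by blast
  have "colourings (l @ v) s = (\<Sum>y \<in> X. colourings ((Death, i) # v) (q @ x # y # flip y # u))"
    using colourings_birth[of "q @ [x]" "Suc i"] by (simp add: zigzag2 s)
  also have "\<dots> = (\<Sum>y \<in> X. if y = flip x then colourings v (q @ flip y # u) else 0)"
    using s by (intro sum.cong) (auto simp: colourings_death)
  also have "\<dots> = colourings v s"
    using assms(4) finite_X flip_in by (simp add: s)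
  finally show ?thesis by (simp add: zigzag2)
next
  case (slide_birth i c)
  have "length s \<ge> Suc i" using assms(2) by (simp add: slide_birth)
  then obtain q y u where s: "s = q @ y # u" "length q = i" using split1 by blast
  have rot: "(a, b) \<in> C c (flip x) y \<longleftrightarrow> (x, a) \<in> C (opposite c) y (flip b)" for a b x
    using rotate[of a b c "flip x" y] by simp
  have in_X: "a \<in> X \<and> b \<in> X" if "(a, b) \<in> C e x y" for a b e x y
    using C_in that by blast
  have "colourings (l @ v) s = (\<Sum>x \<in> X. \<Sum>(a, b) \<in> C c (flip x) y. colourings v (q @ x # a # b # u))"
    using s by (simp add: slide_birth colourings_birth)
      (intro sum.cong refl, use colourings_cross[of "q @ [x]" "Suc i" c v "flip x" y u for x] in simp)
  also have "\<dots> = (\<Sum>(x, a, b) \<in> Sigma X (\<lambda>x. C c (flip x) y). colourings v (q @ x # a # b # u))"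
    by (subst sum.Sigma) (auto simp: finite_X finite_C split_def)
  \<comment> \<open>The turned crossing has \<open>y\<close> and \<open>flip b\<close> on its left
    and \<open>x\<close> and \<open>a\<close> on its right, so the tangency on the other side is
    born with the colour \<open>flip b\<close>.\<close>
  also have "\<dots> = (\<Sum>(x, a, b) \<in> Sigma X (\<lambda>x. C (opposite c) y x). colourings v (q @ a # b # flip x # u))"
    by (rule sum.reindex_bij_witness
        [where j = "\<lambda>(x, a, b). (flip b, x, a)" and i = "\<lambda>(x, a, b). (a, b, flip x)"])
       (auto simp: rot dest: in_X intro: flip_in)
  also have "\<dots> = (\<Sum>x \<in> X. \<Sum>(a, b) \<in> C (opposite c) y x. colourings v (q @ a # b # flip x # u))"
    by (subst sum.Sigma) (auto simp: finite_X finite_C split_def)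
  also have "\<dots> = colourings (r @ v) s"
    using s colourings_birth[of "q @ [y]" "Suc i" _ u] by (simp add: slide_birth colourings_cross)
  finally show ?thesis .
next
  case (slide_death c i)
  have "length s \<ge> Suc (Suc (Suc i))" using assms(2) by (simp add: slide_death)
  then obtain s1 x y z s3 where s: "s = s1 @ x # y # z # s3" "length s1 = i"
    using split3 by blast
  have "colourings (l @ v) s =
      (\<Sum>(a, b) \<in> C c y z. if x = flip a then colourings v (s1 @ b # s3) else 0)"
    using colourings_cross[of "s1 @ [x]" "Suc i" c "(Death, i) # v" y z s3] s
    by (simp add: slide_death colourings_death)
  also have "\<dots> = (\<Sum>(a, b) \<in> {(a, b). (a, b) \<in> C c y z \<and> x = flip a}. colourings v (s1 @ b # s3))"
    by (rule sum.mono_neutral_cong_right) (auto simp: finite_C split: if_splits)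
  also have "\<dots> = (\<Sum>(a, b) \<in> {(a, b). (a, b) \<in> C (opposite c) x y \<and> b = flip z}.
      colourings v (s1 @ a # s3))"
    by (rule sum.reindex_bij_witness
        [where j = "\<lambda>(a, b). (b, flip z)" and i = "\<lambda>(a, b). (flip x, a)"])
       (use rotate[of _ _ "opposite c" x y] in auto)
  also have "\<dots> = (\<Sum>(a, b) \<in> C (opposite c) x y. if b = flip z then colourings v (s1 @ a # s3) else 0)"
    by (rule sum.mono_neutral_cong_left) (auto simp: finite_C split: if_splits)
  also have "\<dots> = colourings (r @ v) s"
    using s colourings_death[of "s1 @ [a]" "Suc i" v b z s3 for a b]
    by (simp add: slide_death colourings_cross split_def cong: if_cong)
  finally show ?thesis .
qed

lemma colourings_RIII:
  assumes "RIII l r" "valid (l @ v) (length s)"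
  shows "colourings (l @ v) s = colourings (r @ v) s"
  using assms(1)
proof cases
  case (1 a c b i)
  have "length s \<ge> Suc (Suc (Suc i))" using assms(2) by (simp add: 1)
  then obtain s1 x y z s3 where s: "s = s1 @ x # y # z # s3" "length s1 = i"
    using split3 by blast
  have "colourings (l @ v) s =
    (\<Sum>(x1, y1) \<in> C a x y. \<Sum>(y2, z1) \<in> C b y1 z. \<Sum>(x2, y3) \<in> C c x1 y2. colourings v (s1 @ x2 # y3 # z1 # s3))"
    using s colourings_cross[of "s1 @ [u]" "Suc i" for u]
    by (simp add: 1 colourings_cross split_def)
  also have "\<dots> =
    (\<Sum>(y1, z1) \<in> C c y z. \<Sum>(x1, y2) \<in> C b x y1. \<Sum>(y3, z2) \<in> C a y2 z1. colourings v (s1 @ x1 # y3 # z2 # s3))"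
    by (rule yang_baxter) (use 1 in auto)
  also have "\<dots> = colourings (r @ v) s"
    using s colourings_cross[of "s1 @ [u]" "Suc i" for u]
    by (simp add: 1 colourings_cross split_def)
  finally show ?thesis .
qed

text \<open>The prefix only rewrites the state; it keeps the colours in \<open>X\<close> and changes
  the length as \<open>valid\<close> predicts, so the local identity applies to every state
  reached.\<close>

lemma colourings_context:
  assumes "\<And>s. valid (l @ v) (length s) \<Longrightarrow> valid (r @ v) (length s) \<Longrightarrow> set s \<subseteq> X \<Longrightarrow>
      colourings (l @ v) s = colourings (r @ v) s"
    and "valid (u @ l @ v) (length s)" "valid (u @ r @ v) (length s)" "set s \<subseteq> X"
  shows "colourings (u @ l @ v) s = colourings (u @ r @ v) s"
  using assms(2-4)
proof (induction u arbitrary: s)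
  case Nil
  then show ?case using assms(1) by simp
next
  case (Cons e u)
  obtain k p where e: "e = (k, p)" by fastforce
  show ?case
    unfolding e append_Cons colourings.simps
  proof (intro sum.cong refl Cons.IH)
    fix ys assume ys: "ys \<in> replacements k (take (ins k) (drop p s))"
    let ?s = "take p s @ ys @ drop (p + ins k) s"
    have "length ?s = length s + outs k - ins k"
      using replacements_in[OF ys] Cons.prems(1) by (simp add: e)
    then show "valid (u @ l @ v) (length ?s)" "valid (u @ r @ v) (length ?s)"
      using Cons.prems by (simp_all add: e)
    show "set ?s \<subseteq> X"
      using replacements_in[OF ys] Cons.prems(3) by (auto dest: in_set_takeD in_set_dropD)
  qed
qed

lemma colourings_in_context:
  assumes "in_context R D E"
    and "\<And>l r v s. R l r \<Longrightarrow> valid (l @ v) (length s) \<Longrightarrow> valid (r @ v) (length s) \<Longrightarrow> set s \<subseteq> X \<Longrightarrow>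
      colourings (l @ v) s = colourings (r @ v) s"
  shows "colourings D [] = colourings E []"
proof -
  obtain u v l r where "R l r" "D = u @ l @ v" "E = u @ r @ v" "closed_word D" "closed_word E"
    using assms(1) unfolding in_context_def by blast
  then show ?thesis
    using colourings_context[of l v r u "[]"] assms(2) by (simp add: closed_word_iff_valid)
qed

lemma colourings_RIII_equivalent:
  assumes "RIII_equivalent D E"
  shows "colourings D [] = colourings E []"
  using assms unfolding RIII_equivalent_def
proof (rule equivclp_invariant)
  fix D E
  assume "in_context (\<lambda>l r. planar l r \<or> RIII l r) D E"
  then show "colourings D [] = colourings E []"
  proof (rule colourings_in_context)
    fix l r v s
    assume "planar l r \<or> RIII l r"
      and valid: "valid (l @ v) (length s)" "valid (r @ v) (length s)" "set s \<subseteq> X"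
    then consider "planar l r" | "RIII l r" by metis
    then show "colourings (l @ v) s = colourings (r @ v) s"
      by cases (rule colourings_planar[OF _ valid] colourings_RIII[OF _ valid(1)]; assumption)+
  qed
qed

end

section \<open>The connected sums\<close>

text \<open>A block is read with two strands present and leaves two. Its letters never touch the
  topmost strand, so a block ties a local knot into the lower strand, and concatenating blocks is
  connected sum. The same holds for \<open>trefoil\<close>.\<close>

definition eight :: "unit sliced" where
  "eight = [(Birth, 1), (Birth, 2), (Cross (), 1), (Cross (), 0), (Birth, 1), (Cross (), 2),
     (Cross (), 3), (Death, 4), (Cross (), 3), (Cross (), 2), (Death, 1), (Cross (), 0),
     (Cross (), 0), (Death, 1)]"

definition trefoil :: "unit sliced" where
  "trefoil = [(Birth, 1), (Cross (), 0), (Birth, 1), (Cross (), 0), (Cross (), 2), (Death, 1),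
     (Death, 1)]"

definition block :: "bool \<Rightarrow> front" where
  "block b = (if b then eight else trefoil)"

definition blocks :: "bool list \<Rightarrow> front" where
  "blocks bs = concat (map block bs)"

definition chain :: "bool list \<Rightarrow> front" where
  "chain bs = (Birth, 0) # blocks bs @ [(Death, 0)]"

lemma blocks_simps [simp]: "blocks [] = []" "blocks (b # bs) = block b @ blocks bs"
  by (simp_all add: blocks_def)

lemma smooth_resolution_simps [simp]:
  "smooth_resolution [] = []"
  "smooth_resolution ((k, p) # F) = (map_piece (\<lambda>_. Descending) k, p) # smooth_resolution F"
  "smooth_resolution (F @ G) = smooth_resolution F @ smooth_resolution G"
  by (simp_all add: smooth_resolution_def)

section \<open>Fox colourings\<close>

datatype colour = Red | Green | Blue

lemma UNIV_colour: "UNIV = {Red, Green, Blue}"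
  using colour.exhaust by auto

text \<open>With colours in the integers modulo 3 this is \<open>- x - y\<close>, which equals both
  \<open>2 x - y\<close> and \<open>2 y - x\<close>.\<close>

fun third :: "colour \<Rightarrow> colour \<Rightarrow> colour" where
  "third Red Red = Red"
| "third Green Green = Green"
| "third Blue Blue = Blue"
| "third Red Green = Blue"
| "third Green Red = Blue"
| "third Red Blue = Green"
| "third Blue Red = Green"
| "third Green Blue = Red"
| "third Blue Green = Red"

definition fox :: "over \<Rightarrow> colour \<Rightarrow> colour \<Rightarrow> (colour \<times> colour) set" where
  "fox c x y = {case c of Descending \<Rightarrow> (y, third x y) | Ascending \<Rightarrow> (third x y, x)}"

text \<open>Fox colours ignore the direction of a strand, hence \<open>flip\<close> is the identity.
  All values of \<open>fox\<close> are singletons, so the Yang-Baxter equation is a finite check of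
  colours.\<close>

interpretation fox: strand_colouring UNIV "\<lambda>x. x" fox
proof
  fix a b c x y
  show "(a, b) \<in> fox c x y \<longleftrightarrow> (x, a) \<in> fox (opposite c) y b"
    by (cases c; cases x; cases y; cases a; cases b; simp add: fox_def)
next
  fix a b c :: over and x y z and f :: "colour \<Rightarrow> colour \<Rightarrow> colour \<Rightarrow> nat"
  assume "a = c \<Longrightarrow> b = a"
  then show "(\<Sum>(x1, y1) \<in> fox a x y. \<Sum>(y2, z1) \<in> fox b y1 z. \<Sum>(x2, y3) \<in> fox c x1 y2. f x2 y3 z1) =
      (\<Sum>(y1, z1) \<in> fox c y z. \<Sum>(x1, y2) \<in> fox b x y1. \<Sum>(y3, z2) \<in> fox a y2 z1. f x1 y3 z2)"
    by (cases a; cases b; cases c; simp add: fox_def; cases x; cases y; cases z; simp)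
next
  show "finite (UNIV :: colour set)"
    by (simp add: UNIV_colour)
qed simp_all

lemma fox_RI:
  assumes "RI l r" "valid (l @ v) (length s)"
  shows "fox.colourings (l @ v) s = fox.colourings (r @ v) s"
  using assms(1)
proof cases
  case (1 i c)
  have "s = take i s @ drop i s" "length (take i s) = i"
    using assms(2) by (simp_all add: 1)
  then obtain s1 s2 where s: "s = s1 @ s2" "length s1 = i" by blast
  have "fox c x x = {(x, x)}" for x
    by (cases c; cases x; simp add: fox_def)
  then show ?thesis
    by (simp add: 1 s fox.colourings_birth fox.colourings_cross)
qed

lemma fox_RII:
  assumes "RII l r" "valid (l @ v) (length s)"
  shows "fox.colourings (l @ v) s = fox.colourings (r @ v) s"
  using assms(1)
proof cases
  case (1 c i)
  have "length s \<ge> i + 2" using assms(2) by (simp add: 1)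
  then obtain s1 xs s2 where s: "s = s1 @ xs @ s2" "length s1 = i" "length xs = 2"
    using split_at by blast
  then obtain x y where xs: "xs = [x, y]"
    by (auto simp: numeral_2_eq_2 length_Suc_conv)
  have "(\<Sum>(a, b) \<in> fox c x y. \<Sum>(a', b') \<in> fox (opposite c) a b. f a' b') = f x y" for f :: "_ \<Rightarrow> _ \<Rightarrow> nat"
    by (cases c; cases x; cases y; simp add: fox_def)
  then show ?thesis
    using s by (simp add: 1 xs fox.colourings_cross)
qed

lemma fox_same_knot:
  assumes "same_knot D E"
  shows "fox.colourings D [] = fox.colourings E []"
  using assms unfolding same_knot_def
proof (rule equivclp_invariant)
  fix D E
  assume "in_context (\<lambda>l r. planar l r \<or> RI l r \<or> RII l r \<or> RIII l r) D E"
  then show "fox.colourings D [] = fox.colourings E []"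
  proof (rule fox.colourings_in_context)
    fix l r v :: diagram and s :: "colour list"
    assume "planar l r \<or> RI l r \<or> RII l r \<or> RIII l r"
      and valid: "valid (l @ v) (length s)" "valid (r @ v) (length s)" "set s \<subseteq> UNIV"
    then consider "planar l r" | "RI l r" | "RII l r" | "RIII l r" by metis
    then show "fox.colourings (l @ v) s = fox.colourings (r @ v) s"
      by cases (rule fox.colourings_planar[OF _ valid] fox_RI[OF _ valid(1)] fox_RII[OF _ valid(1)]
          fox.colourings_RIII[OF _ valid(1)]; assumption)+
  qed
qed


section \<open>Evaluation of the 3-colourings on the blocks\<close>

lemma fox_birth:
  "fox.colourings ((Birth, p) # w) s =
     (let f = (\<lambda>x. fox.colourings w (take p s @ [x, x] @ drop p s)) in f Red + f Green + f Blue)"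
proof -
  have "sum f (UNIV :: colour set) = f Red + f Green + f Blue" for f :: "colour \<Rightarrow> nat"
    by (simp add: UNIV_colour)
  moreover have "inj (\<lambda>x :: colour. [x, x])"
    by (simp add: inj_on_def)
  ultimately show ?thesis
    by (simp add: fox.colourings.simps fox.replacements_def sum.reindex Let_def)
qed

lemma fox_death:
  "p + 2 \<le> length s \<Longrightarrow> fox.colourings ((Death, p) # w) s =
     (if s ! p = s ! Suc p then fox.colourings w (take p s @ drop (p + 2) s) else 0)"
  by (simp add: fox.colourings.simps fox.replacements_def)

lemma fox_cross:
  "p + 2 \<le> length s \<Longrightarrow> fox.colourings ((Cross Descending, p) # w) s =
     fox.colourings w (take p s @ [s ! Suc p, third (s ! p) (s ! Suc p)] @ drop (p + 2) s)"
  by (simp add: fox.colourings.simps fox.replacements_def fox_def)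

text \<open>Each local knot has three colourings for every colour of the strand it is tied into, and
  each of them gives both ends of that strand the same colour.\<close>

lemma fox_block:
  "fox.colourings (smooth_resolution (block b) @ w) [x, x] = 3 * fox.colourings w [x, x]"
  by (cases b; cases x) (simp_all add: block_def eight_def trefoil_def fox_birth fox_death fox_cross numeral_eq_Suc)

lemma fox_blocks:
  "fox.colourings (smooth_resolution (blocks bs) @ w) [x, x] = 3 ^ length bs * fox.colourings w [x, x]"
  by (induction bs) (simp_all add: fox_block)

lemma fox_chain: "fox.colourings (smooth_resolution (chain bs)) [] = 3 ^ Suc (length bs)"
  by (simp add: chain_def fox_birth fox_blocks fox_death)

lemma chain_not_unknot:
  assumes "bs \<noteq> []"
  shows "\<not> unknot (smooth_resolution (chain bs))"
proof
  assume "unknot (smooth_resolution (chain bs))"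
  \<comment> \<open>The empty chain consists of the two outer cusps alone, which is the diagram in
    the definition of \<open>unknot\<close>.\<close>
  then have "fox.colourings (smooth_resolution (chain bs)) [] = fox.colourings (smooth_resolution (chain [])) []"
    unfolding unknot_def by (auto dest!: fox_same_knot simp: chain_def)
  then show False
    using assms unfolding fox_chain by simp
qed

section \<open>Gauss codes\<close>

text \<open>An edge of a Gauss code with a direction; the flag tells whether it is directed to the right.\<close>

type_synonym edge = "int \<times> bool"

definition reverse :: "edge \<Rightarrow> edge" where
  "reverse e = (fst e, \<not> snd e)"

text \<open>The entry \<open>((o, o'), (u, u'))\<close> is a crossing whose over-strand leads from the edge \<open>o\<close> to \<open>o'\<close>
  and whose under-strand leads from \<open>u\<close> to \<open>u'\<close>. The edges \<open>1, \<dots>, 15\<close> lie in \<open>eight\<close>, the edges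
  \<open>16, \<dots>, 20\<close> in \<open>trefoil\<close>, and \<open>0\<close> stands for all strands between two blocks.\<close>

definition gauss_code :: "((int \<times> int) \<times> (int \<times> int)) list" where
  "gauss_code =
    [((12, 13), (7, 8)), ((13, 14), (0, 1)), ((1, 2), (10, 11)), ((6, 7), (11, 12)),
     ((8, 9), (5, 6)), ((9, 10), (2, 3)), ((3, 4), (14, 15)), ((15, 0), (4, 5)),
     ((18, 19), (0, 16)), ((20, 0), (17, 18)), ((16, 17), (19, 20))]"

definition passages :: "int \<times> int \<Rightarrow> (edge \<times> edge) list" where
  "passages e = [((fst e, True), (snd e, True)), ((snd e, False), (fst e, False))]"

text \<open>The colours \<open>((x, y), (a, b))\<close> of the strands entering and leaving a crossing, both from below.\<close>

definition crossing_table :: "over \<Rightarrow> ((edge \<times> edge) \<times> (edge \<times> edge)) list" where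
  "crossing_table c = concat (map (\<lambda>(o1, u1).
     concat (map (\<lambda>(o2, o3). map (\<lambda>(u2, u3).
       case c of Descending \<Rightarrow> ((u2, o2), (o3, u3)) | Ascending \<Rightarrow> ((o2, u2), (u3, o3)))
     (passages u1)) (passages o1))) gauss_code)"

text \<open>The directions of the two passages are combined in all four ways, so the signs of the
  crossings are forgotten. This only admits more labellings, and the exclusions below hold for all
  of them.\<close>

definition gauss :: "over \<Rightarrow> edge \<Rightarrow> edge \<Rightarrow> (edge \<times> edge) set" where
  "gauss c x y = {ab. ((x, y), ab) \<in> set (crossing_table c)}"

definition edges :: "edge set" where
  "edges = {0..20} \<times> UNIV"

lemma gauss_in: "gauss c x y \<subseteq> edges \<times> edges"
proof -
  have "\<forall>c \<in> {Descending, Ascending}. \<forall>(xy, a, b) \<in> set (crossing_table c).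
      0 \<le> fst a \<and> fst a \<le> 20 \<and> 0 \<le> fst b \<and> fst b \<le> 20"
    by code_simp
  then show ?thesis
    unfolding gauss_def edges_def by (cases c) fastforce+
qed

text \<open>The two conjuncts are the quarter turns in the two senses; together they give both
  directions of the equivalence \<open>rotate\<close>.\<close>

lemma crossing_table_rotate:
  "\<forall>c \<in> {Descending, Ascending}. \<forall>((x, y), (a, b)) \<in> set (crossing_table c).
     ((y, reverse b), (reverse x, a)) \<in> set (crossing_table (opposite c)) \<and>
     ((reverse a, x), (b, reverse y)) \<in> set (crossing_table (opposite c))"
  by code_simp

section \<open>Absence of monogons, bigons and ordered triangles\<close>

lemma no_monogon:
  "\<forall>c \<in> {Descending, Ascending}. \<forall>((x, y), _) \<in> set (crossing_table c). y \<noteq> reverse x"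
  by code_simp

lemma no_bigon:
  "\<forall>c \<in> {Descending, Ascending}. \<forall>(_, ab) \<in> set (crossing_table c).
     \<forall>(xy, _) \<in> set (crossing_table (opposite c)). ab \<noteq> xy"
  by code_simp

text \<open>The labels \<open>x1\<close>, \<open>y1\<close> and \<open>y2\<close> are the sides of
  the triangle on the left of \<open>RIII\<close>. The tests stand between the loops so that
  evaluation scans the third table only after the first two crossings match.\<close>

definition triangle_free :: "((edge \<times> edge) \<times> (edge \<times> edge)) list \<Rightarrow> _ \<Rightarrow> _ \<Rightarrow> bool" where
  "triangle_free as bs cs = list_all (\<lambda>((x, y), (x1, y1)). list_all (\<lambda>((y1', z), (y2, z1)).
     if y1 = y1' then list_all (\<lambda>((x1', y2'), _). if x1 = x1' then y2 \<noteq> y2' else True) cs else True) bs) as"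

text \<open>Of the eight triples these are the six in which \<open>a = c\<close> implies
  \<open>b = a\<close>, that is, those that the side condition of \<open>RIII\<close>
  allows.\<close>

lemma no_triangle:
  "\<forall>(a, b, c) \<in> {(Descending, Descending, Descending), (Descending, Descending, Ascending),
       (Descending, Ascending, Ascending), (Ascending, Descending, Descending),
       (Ascending, Ascending, Descending), (Ascending, Ascending, Ascending)}.
     triangle_free (crossing_table a) (crossing_table b) (crossing_table c)"
  by code_simp

lemma triangle_freeD:
  assumes "triangle_free as bs cs" "((x, y), (x1, y1)) \<in> set as" "((y1, z), (y2, z1)) \<in> set bs"
  shows "((x1, y2), w) \<notin> set cs"
proof
  assume w: "((x1, y2), w) \<in> set cs"
  have "\<forall>((y1', z), (y2, z1)) \<in> set bs.
      if y1 = y1' then \<forall>((x1', y2'), _) \<in> set cs. if x1 = x1' then y2 \<noteq> y2' else True else True"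
    using bspec[OF assms(1)[unfolded triangle_free_def list_all_iff] assms(2)] by simp
  from bspec[OF this assms(3)]
  have "\<forall>((x1', y2'), _) \<in> set cs. if x1 = x1' then y2 \<noteq> y2' else True"
    by simp
  from bspec[OF this w] show False
    by simp
qed

lemma gauss_iff: "(a, b) \<in> gauss c x y \<longleftrightarrow> ((x, y), (a, b)) \<in> set (crossing_table c)"
  by (simp add: gauss_def)

lemma gauss_rotateD:
  assumes "(a, b) \<in> gauss c x y"
  shows "(reverse x, a) \<in> gauss (opposite c) y (reverse b)"
    and "(b, reverse y) \<in> gauss (opposite c) (reverse a) x"
  using crossing_table_rotate assms by (cases c; fastforce simp: gauss_iff)+

lemma reverse_reverse [simp]: "reverse (reverse e) = e"
  by (simp add: reverse_def)

lemma gauss_rotate: "(a, b) \<in> gauss c x y \<longleftrightarrow> (reverse x, a) \<in> gauss (opposite c) y (reverse b)"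
  using gauss_rotateD(1)[of a b c x y] gauss_rotateD(2)[of "reverse x" a "opposite c" y "reverse b"]
  by auto

text \<open>The rotation by a half-turn exchanges the two sides of a third Reidemeister move.\<close>

lemma gauss_half_turn: "(a, b) \<in> gauss c x y \<Longrightarrow> (reverse y, reverse x) \<in> gauss c (reverse b) (reverse a)"
  using gauss_rotateD(1)[OF gauss_rotateD(1)] by simp

lemma gauss_triangle:
  assumes "a = c \<Longrightarrow> b = a" "(x1, y1) \<in> gauss a x y" "(y2, z1) \<in> gauss b y1 z"
  shows "gauss c x1 y2 = {}"
proof -
  have "triangle_free (crossing_table a) (crossing_table b) (crossing_table c)"
    using assms(1) no_triangle by (cases a; cases b; cases c; simp)
  then have "((x1, y2), w) \<notin> set (crossing_table c)" for w
    using assms(2,3) unfolding gauss_iff by (metis triangle_freeD)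
  then show ?thesis
    by (auto simp: gauss_def)
qed

lemma gauss_triangle':
  assumes "a = c \<Longrightarrow> b = a" "(y1, z1) \<in> gauss c y z" "(x1, y2) \<in> gauss b x y1"
  shows "gauss a y2 z1 = {}"
proof (rule equals0I)
  fix w assume "w \<in> gauss a y2 z1"
  then obtain y3 z2 where "(y3, z2) \<in> gauss a y2 z1" by (cases w) auto
  \<comment> \<open>The half-turn reverses the order of the three crossings and so carries the right
    side of \<open>RIII\<close>, read backwards, to the left side with the same \<open>a\<close>,
    \<open>b\<close>, \<open>c\<close>.\<close>
  from gauss_triangle[OF assms(1) gauss_half_turn[OF this] gauss_half_turn[OF assms(3)]]
    gauss_half_turn[OF assms(2)]
  show False by simp
qed

text \<open>The Yang-Baxter equation reads 0 = 0: on either side the first two crossings leave no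
  admissible third one.\<close>

interpretation gauss: strand_colouring edges reverse gauss
proof
  fix a b c :: over and x y z and f :: "edge \<Rightarrow> edge \<Rightarrow> edge \<Rightarrow> nat"
  assume *: "a = c \<Longrightarrow> b = a"
  have e1: False if "(x1, y1) \<in> gauss a x y" "(y2, z1) \<in> gauss b y1 z" "w \<in> gauss c x1 y2" for x1 y1 y2 z1 w
    using gauss_triangle[OF * that(1,2)] that(3) by simp
  have e2: False if "(y1, z1) \<in> gauss c y z" "(x1, y2) \<in> gauss b x y1" "w \<in> gauss a y2 z1" for x1 y1 y2 z1 w
    using gauss_triangle'[OF * that(1,2)] that(3) by simp
  have "(\<Sum>(x1, y1) \<in> gauss a x y. \<Sum>(y2, z1) \<in> gauss b y1 z. \<Sum>(x2, y3) \<in> gauss c x1 y2. f x2 y3 z1) = 0"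
    by (intro sum.neutral ballI) (auto simp: split_def intro!: sum.neutral dest: e1)
  moreover have "(\<Sum>(y1, z1) \<in> gauss c y z. \<Sum>(x1, y2) \<in> gauss b x y1. \<Sum>(y3, z2) \<in> gauss a y2 z1. f x1 y3 z2) = 0"
    by (intro sum.neutral ballI) (auto simp: split_def intro!: sum.neutral dest: e2)
  ultimately show "(\<Sum>(x1, y1) \<in> gauss a x y. \<Sum>(y2, z1) \<in> gauss b y1 z. \<Sum>(x2, y3) \<in> gauss c x1 y2. f x2 y3 z1) =
      (\<Sum>(y1, z1) \<in> gauss c y z. \<Sum>(x1, y2) \<in> gauss b x y1. \<Sum>(y3, z2) \<in> gauss a y2 z1. f x1 y3 z2)"
    by simp
next
  show "(a, b) \<in> gauss c x y \<longleftrightarrow> (reverse x, a) \<in> gauss (opposite c) y (reverse b)" for a b c x y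
    by (rule gauss_rotate)
  show "gauss c x y \<subseteq> edges \<times> edges" for c x y
    by (rule gauss_in)
qed (auto simp: edges_def reverse_def)

section \<open>Vanishing and positivity of the Gauss state sum\<close>

lemma gauss_RI: "RI l r \<Longrightarrow> valid (l @ v) (length s) \<Longrightarrow> gauss.colourings (l @ v) s = 0"
proof (induction rule: RI.cases)
  case (1 i c)
  have "s = take i s @ drop i s" "length (take i s) = i"
    using 1 by simp_all
  then obtain s1 s2 where s: "s = s1 @ s2" "length s1 = i" by blast
  have "gauss c x (reverse x) = {}" for x
    using no_monogon by (cases c) (fastforce simp: gauss_def)+
  then show ?case
    using 1 s by (simp add: gauss.colourings_birth gauss.colourings_cross)
qed

lemma gauss_RII: "RII l r \<Longrightarrow> valid (l @ v) (length s) \<Longrightarrow> gauss.colourings (l @ v) s = 0"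
proof (induction rule: RII.cases)
  case (1 c i)
  have "length s \<ge> i + 2" using 1 by simp
  then obtain s1 xs s2 where s: "s = s1 @ xs @ s2" "length s1 = i" "length xs = 2"
    using split_at by blast
  then obtain x y where xs: "xs = [x, y]"
    by (auto simp: numeral_2_eq_2 length_Suc_conv)
  have "gauss (opposite c) a b = {}" if "(a, b) \<in> gauss c x y" for a b
    using no_bigon that by (cases c) (fastforce simp: gauss_def)+
  then have "(\<Sum>(a, b) \<in> gauss c x y. gauss.colourings ((Cross (opposite c), i) # v) (s1 @ a # b # s2)) = 0"
    using s by (intro sum.neutral) (auto simp: gauss.colourings_cross)
  then show ?case
    using 1 s xs by (simp add: gauss.colourings_cross)
qed

text \<open>Whatever state the prefix produces, the monogon or bigon that follows has no labelling,
  so every summand vanishes.\<close>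

lemma gauss_crossing_decreasing:
  assumes "crossing_decreasing D E"
  shows "gauss.colourings D [] = 0"
proof -
  obtain u v l r where lr: "RI l r \<or> RII l r" "D = u @ l @ v" "valid D 0"
    using assms unfolding crossing_decreasing_def in_context_def closed_word_iff_valid by blast
  have "gauss.colourings (u @ l @ v) s = 0" if "valid (u @ l @ v) (length s)" for s
    using that
  proof (induction u arbitrary: s)
    case Nil
    then show ?case using lr(1) gauss_RI gauss_RII by auto
  next
    case (Cons e u)
    obtain k p where e: "e = (k, p)" by fastforce
    show ?case
      unfolding e append_Cons gauss.colourings.simps
    proof (intro sum.neutral ballI Cons.IH)
      fix ys assume ys: "ys \<in> gauss.replacements k (take (ins k) (drop p s))"
      have "length (take p s @ ys @ drop (p + ins k) s) = length s + outs k - ins k"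
        using gauss.replacements_in[OF ys] Cons.prems(1) by (simp add: e)
      then show "valid (u @ l @ v) (length (take p s @ ys @ drop (p + ins k) s))"
        using Cons.prems by (simp add: e)
    qed
  qed
  from this[of "[]"] show ?thesis
    using lr(2,3) by simp
qed

text \<open>The second argument lists the colours of the strands created by the successive births.\<close>

fun follow :: "diagram \<Rightarrow> edge list \<Rightarrow> edge list \<Rightarrow> edge list option" where
  "follow [] bs s = Some s"
| "follow ((Birth, p) # w) [] s = None"
| "follow ((Birth, p) # w) (x # bs) s = follow w bs (take p s @ [x, reverse x] @ drop p s)"
| "follow ((Death, p) # w) bs s =
     (if p + 2 \<le> length s \<and> s ! p = reverse (s ! Suc p) then follow w bs (take p s @ drop (p + 2) s) else None)"
| "follow ((Cross c, p) # w) bs s =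
     (if p + 2 \<le> length s then
        case map_of (crossing_table c) (s ! p, s ! Suc p) of None \<Rightarrow> None
        | Some (a, b) \<Rightarrow> follow w bs (take p s @ [a, b] @ drop (p + 2) s)
      else None)"

text \<open>Positivity needs one labelling only. Exhibiting it avoids a sum over 42 directed edges
  at every birth.\<close>

lemma colourings_follow:
  "follow u bs s = Some t \<Longrightarrow> set bs \<subseteq> edges \<Longrightarrow> 0 < gauss.colourings w t \<Longrightarrow>
   0 < gauss.colourings (u @ w) s"
proof (induction u bs s rule: follow.induct)
  case (3 p u x bs s)
  then have "0 < gauss.colourings (u @ w) (take p s @ [x, reverse x] @ drop p s)"
    by simp
  moreover have "[x, reverse x] \<in> gauss.replacements Birth []"
    using 3 by (auto simp: gauss.replacements_def)
  ultimately show ?case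
    by (simp add: gauss.colourings.simps sum_pos2[OF gauss.finite_replacements])
next
  case (5 c p u bs s)
  then obtain a b where ab: "map_of (crossing_table c) (s ! p, s ! Suc p) = Some (a, b)" "p + 2 \<le> length s"
    and "0 < gauss.colourings (u @ w) (take p s @ [a, b] @ drop (p + 2) s)"
    by (auto split: if_splits option.splits)
  moreover have "[a, b] \<in> gauss.replacements (Cross c) (take 2 (drop p s))"
    using map_of_SomeD[OF ab(1)] ab(2)
    by (force simp: gauss.replacements_def gauss_iff)
  ultimately show ?case
    by (simp add: gauss.colourings.simps sum_pos2[OF gauss.finite_replacements])
next
  case (4 p u bs s)
  then have "p + 2 \<le> length s" "s ! p = reverse (s ! Suc p)"
    "0 < gauss.colourings (u @ w) (take p s @ drop (p + 2) s)"
    by (auto split: if_splits)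
  then show ?case
    by (simp add: gauss.colourings.simps gauss.replacements_def)
qed (auto simp: gauss.colourings.simps)


lemma reverse_simp [simp]: "reverse (e, d) = (e, \<not> d)"
  by (simp add: reverse_def)

lemma gauss_block:
  assumes "0 < gauss.colourings w [(0, True), (0, False)]"
  shows "0 < gauss.colourings (smooth_resolution (block b) @ w) [(0, True), (0, False)]"
proof -
  \<comment> \<open>These are the edges containing the left tangencies, each with the direction of
    its lower strand. The lower strand between blocks carries \<open>(0, True)\<close>, the
    untouched top strand \<open>(0, False)\<close>.\<close>
  let ?bs = "if b then [(8, False), (12, True), (10, False)] else [(19, False), (20, True)]"
  have "\<forall>b. follow (smooth_resolution (block b))
      (if b then [(8, False), (12, True), (10, False)] else [(19, False), (20, True)])
      [(0, True), (0, False)] = Some [(0, True), (0, False)]"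
    by code_simp
  then show ?thesis
    by (intro colourings_follow[where bs = ?bs, OF _ _ assms]) (auto simp: edges_def)
qed

lemma gauss_chain: "0 < gauss.colourings (smooth_resolution (chain bs)) []"
proof -
  have "0 < gauss.colourings (smooth_resolution (blocks bs) @ [(Death, 0)]) [(0, True), (0, False)]"
  proof (induction bs)
    case Nil
    then show ?case by (simp add: gauss.colourings.simps gauss.replacements_def)
  next
    case (Cons b bs)
    then show ?case using gauss_block by simp
  qed
  then show ?thesis
    using colourings_follow[of "[(Birth, 0)]" "[(0, True)]" "[]"]
    by (simp add: chain_def edges_def)
qed

lemma chain_not_decreasing:
  assumes "RIII_equivalent (smooth_resolution (chain bs)) D"
  shows "\<not> crossing_decreasing D E"
  using gauss.colourings_RIII_equivalent[OF assms] gauss_chain[of bs] gauss_crossing_decreasing[of D E]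
  by auto

section \<open>Labellings of the strands\<close>

text \<open>One notion serves three purposes: orientations, where \<open>flip\<close> is negation,
  and connectedness and ruling disks, where it is the identity. Unlike in
  \<open>strand_colouring\<close>, labels pass through crossings unchanged.\<close>

definition label_step :: "('x \<Rightarrow> 'x) \<Rightarrow> 'c piece \<Rightarrow> nat \<Rightarrow> 'x list \<Rightarrow> 'x list \<Rightarrow> bool" where
  "label_step flip k p s s' \<longleftrightarrow> p + ins k \<le> length s \<and>
     (\<exists>ys. length ys = outs k \<and> s' = take p s @ ys @ drop (p + ins k) s \<and>
       (case k of Birth \<Rightarrow> ys ! 1 = flip (ys ! 0)
        | Death \<Rightarrow> s ! Suc p = flip (s ! p)
        | Cross c \<Rightarrow> ys = [s ! Suc p, s ! p]))"

definition label_run :: "('x \<Rightarrow> 'x) \<Rightarrow> 'c sliced \<Rightarrow> (nat \<Rightarrow> 'x list) \<Rightarrow> bool" where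
  "label_run flip w S \<longleftrightarrow>
     (\<forall>t < length w. label_step flip (fst (w ! t)) (snd (w ! t)) (S t) (S (Suc t)))"

lemma label_step_simps:
  "label_step flip Birth p s s' \<longleftrightarrow>
     p \<le> length s \<and> (\<exists>x. s' = take p s @ [x, flip x] @ drop p s)"
  "label_step flip Death p s s' \<longleftrightarrow>
     p + 2 \<le> length s \<and> s ! Suc p = flip (s ! p) \<and> s' = take p s @ drop (p + 2) s"
  "label_step flip (Cross c) p s s' \<longleftrightarrow>
     p + 2 \<le> length s \<and> s' = take p s @ [s ! Suc p, s ! p] @ drop (p + 2) s"
  by (auto simp: label_step_def length_Suc_conv numeral_2_eq_2)

lemma label_run_Nil [simp]: "label_run flip [] S"
  by (simp add: label_run_def)

lemma label_run_Cons:
  "label_run flip ((k, p) # w) S \<longleftrightarrow>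
     label_step flip k p (S 0) (S 1) \<and> label_run flip w (\<lambda>t. S (Suc t))"
  unfolding label_run_def by (auto simp: nth_Cons split: nat.splits)

lemma closed_wordD:
  "closed_word w \<Longrightarrow> t < length w \<Longrightarrow> snd (w ! t) + ins (fst (w ! t)) \<le> strands w t"
  by (simp add: closed_word_def)

text \<open>This passes from functions on points to lists of labels that can be computed letter by
  letter; \<open>label_run_through\<close> and \<open>label_run_turn\<close> lead back.\<close>

lemma label_run_of_points:
  assumes "closed_word w"
    and through: "\<And>P Q. through w P Q \<Longrightarrow> f P = f Q"
    and turn: "\<And>P Q. turn w P Q \<Longrightarrow> f Q = flip (f P)"
  shows "label_run flip w (\<lambda>t. map (\<lambda>j. f (t, j)) [0..<strands w t])"
  unfolding label_run_def
proof (intro allI impI)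
  fix t assume t: "t < length w"
  obtain k p where kp: "w ! t = (k, p)" by fastforce
  have p: "p + ins k \<le> strands w t"
    using closed_wordD[OF assms(1) t] by (simp add: kp)
  define s where "s = map (\<lambda>j. f (t, j)) [0..<strands w t]"
  define s' where "s' = map (\<lambda>j. f (Suc t, j)) [0..<strands w (Suc t)]"
  define ys where "ys = map (\<lambda>j. f (Suc t, j)) [p..<p + outs k]"
  have "s' = take p s @ ys @ drop (p + ins k) s"
  proof (rule nth_equalityI)
    show "length s' = length (take p s @ ys @ drop (p + ins k) s)"
      using p by (simp add: s_def s'_def ys_def kp)
    fix j assume j: "j < length s'"
    consider "j < p" | "p \<le> j" "j < p + outs k" | i where "j = p + outs k + i"
      by (metis le_add_diff_inverse not_less)
    then show "s' ! j = (take p s @ ys @ drop (p + ins k) s) ! j"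
    proof cases
      case 1
      then show ?thesis
        using through[OF through.below[OF t kp 1]] p j by (simp add: s_def s'_def nth_append)
    next
      case 2
      then show ?thesis
        using p j by (auto simp: s_def s'_def ys_def nth_append)
    next
      case 3
      then have i: "p + ins k + i < strands w t"
        using p j by (simp add: s'_def kp)
      show ?thesis
        using through[OF through.above[OF t kp i]] p j i 3 by (simp add: s_def s'_def ys_def nth_append)
    qed
  qed
  moreover have "case k of Birth \<Rightarrow> ys ! 1 = flip (ys ! 0) | Death \<Rightarrow> s ! Suc p = flip (s ! p)
      | Cross c \<Rightarrow> ys = [s ! Suc p, s ! p]"
  proof (cases k)
    case Birth
    then show ?thesis
      using turn[OF turn.birth[of t w p]] t kp by (simp add: ys_def)
  next
    case Death
    then show ?thesis
      using turn[OF turn.death[of t w p]] t kp p by (simp add: s_def)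
  next
    case (Cross c)
    have "s ! p = f (t, p)" "s ! Suc p = f (t, Suc p)"
      using p Cross by (simp_all add: s_def)
    moreover have "ys = [f (Suc t, p), f (Suc t, Suc p)]"
      using Cross by (simp add: ys_def upt_conv_Cons)
    ultimately show ?thesis
      using through[OF through.ascend[of t w c p]] through[OF through.descend[of t w c p]] t kp Cross
      by simp
  qed
  ultimately show "label_step flip (fst (w ! t)) (snd (w ! t)) s s'"
    unfolding label_step_def kp fst_conv snd_conv
    by (intro conjI exI[of _ ys]) (use p in \<open>simp_all add: s_def ys_def\<close>)
qed

lemma length_label_run:
  assumes "label_run flip w S" "S 0 = []" "t \<le> length w"
  shows "length (S t) = strands w t"
  using assms(3)
proof (induction t)
  case (Suc t)
  then have "label_step flip (fst (w ! t)) (snd (w ! t)) (S t) (S (Suc t))"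
    using assms(1) by (simp add: label_run_def)
  then show ?case
    using Suc by (auto simp: label_step_def)
qed (simp add: assms(2))

lemma label_run_through:
  assumes "label_run flip w S" "S 0 = []" "through w (t, i) (t', j)"
  shows "S t ! i = S t' ! j"
proof -
  have step: "label_step flip k p (S t) (S (Suc t))" if "t < length w" "w ! t = (k, p)" for t k p
    using assms(1) that by (auto simp: label_run_def)
  note len = length_label_run[OF assms(1,2)]
  show ?thesis
    using assms(3)
  proof cases
    case (below k p)
    then show ?thesis
      using step[of t k p] below by (auto simp: label_step_def nth_append)
  next
    case (above k p j)
    then show ?thesis
      using step[of t k p] above len[of t] by (auto simp: label_step_def nth_append)
  next
    case (ascend c)
    then show ?thesis
      using step[of t "Cross c" i] ascend by (auto simp: label_step_simps nth_append)
  next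
    case (descend c)
    then show ?thesis
      using step[of t "Cross c" j] descend by (auto simp: label_step_simps nth_append)
  qed
qed

lemma label_run_turn:
  assumes "label_run flip w S" "turn w (t, i) (t', j)"
  shows "S t' ! j = flip (S t ! i)"
proof -
  have step: "label_step flip k p (S t) (S (Suc t))" if "t < length w" "w ! t = (k, p)" for t k p
    using assms(1) that by (auto simp: label_run_def)
  show ?thesis
    using assms(2)
  proof cases
    case (birth t)
    then show ?thesis
      using step[of t Birth i] by (auto simp: label_step_simps nth_append)
  next
    case death
    then show ?thesis
      using step[of t Death i] by (auto simp: label_step_simps nth_append)
  qed
qed

section \<open>Writhe\<close>

fun writhes :: "diagram \<Rightarrow> bool list \<Rightarrow> int set" where
  "writhes [] s = {0}"
| "writhes ((Birth, p) # w) s = (\<Union>b. writhes w (take p s @ [b, \<not> b] @ drop p s))"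
| "writhes ((Death, p) # w) s =
     (if s ! p = s ! Suc p then {} else writhes w (take p s @ drop (p + 2) s))"
| "writhes ((Cross c, p) # w) s =
     (\<lambda>x. (if (s ! p = s ! Suc p) = (c = Descending) then 1 else - 1) + x) `
       writhes w (take p s @ [s ! Suc p, s ! p] @ drop (p + 2) s)"

definition letter_sign :: "over piece \<times> nat \<Rightarrow> bool list \<Rightarrow> int" where
  "letter_sign e s = (case e of
     (Cross c, p) \<Rightarrow> (if (s ! p = s ! Suc p) = (c = Descending) then 1 else - 1)
   | _ \<Rightarrow> 0)"

lemma label_run_writhe:
  "label_run Not w S \<Longrightarrow> (\<Sum>t < length w. letter_sign (w ! t) (S t)) \<in> writhes w (S 0)"
proof (induction w arbitrary: S)
  case (Cons e w)
  obtain k p where e: "e = (k, p)" by fastforce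
  have "(\<Sum>t < length w. letter_sign (w ! t) (S (Suc t))) \<in> writhes w (S 1)"
    using Cons.IH[of "\<lambda>t. S (Suc t)"] Cons.prems by (simp add: e label_run_Cons)
  moreover have "label_step Not k p (S 0) (S 1)"
    using Cons.prems by (simp add: e label_run_Cons)
  ultimately show ?case
    by (cases k) (auto simp: e label_step_simps letter_sign_def sum.lessThan_Suc_shift
        simp del: sum.lessThan_Suc)
qed simp

lemma label_run_exists:
  "valid w (length s) \<Longrightarrow> writhes w s \<noteq> {} \<Longrightarrow> \<exists>S. S 0 = s \<and> label_run Not w S"
proof (induction w arbitrary: s)
  case (Cons e w)
  obtain k p where e: "e = (k, p)" by fastforce
  obtain s' where s': "label_step Not k p s s'" "writhes w s' \<noteq> {}"
    using Cons.prems by (cases k) (auto simp: e label_step_simps split: if_splits)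
  then have "length s' = length s + outs k - ins k"
    by (auto simp: label_step_def)
  then have "valid w (length s')"
    using Cons.prems(1) by (simp add: e)
  from Cons.IH[OF this s'(2)] obtain S where S: "S 0 = s'" "label_run Not w S"
    by blast
  then have "label_run Not (e # w) (case_nat s S)"
    using s' by (simp add: e label_run_Cons)
  then show ?case
    by (metis old.nat.simps(4))
qed auto

text \<open>\<open>writhe\<close> takes its orientation by Hilbert choice. The set
  \<open>writhes D []\<close> collects the values over all orientations: being non-empty it provides
  an orientation, and being a singleton it makes the choice irrelevant.\<close>

lemma writhe_eqI:
  assumes "closed_word D" "writhes D [] = {x}"
  shows "writhe D = x"
proof -
  obtain S where S: "S 0 = []" "label_run Not D S"
    using label_run_exists[of D "[]"] assms by (auto simp: closed_word_iff_valid)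
  have "orientation D (\<lambda>(t, j). S t ! j)"
    unfolding orientation_def
    using label_run_through[OF S(2,1)] label_run_turn[OF S(2)] by auto
  then have d: "orientation D (SOME d. orientation D d)" (is "orientation D ?d")
    by (rule someI[of "orientation D"])
  let ?S = "\<lambda>t. map (\<lambda>j. ?d (t, j)) [0..<strands D t]"
  have "label_run Not D ?S"
    using d unfolding orientation_def by (intro label_run_of_points[OF assms(1)]) blast+
  from label_run_writhe[OF this] have "(\<Sum>t < length D. letter_sign (D ! t) (?S t)) = x"
    using assms(2) by simp
  moreover have "letter_sign (D ! t) (?S t) = crossing_sign D ?d t" if "t < length D" for t
    using closed_wordD[OF assms(1) that]
    by (auto simp: letter_sign_def crossing_sign_def split: prod.splits piece.splits)
  ultimately show ?thesis
    unfolding writhe_def by simp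
qed

section \<open>Connectedness\<close>

text \<open>\<open>H\<close> collects the labels that have occurred.\<close>

fun forces_constant :: "'c sliced \<Rightarrow> 'x list \<Rightarrow> 'x set \<Rightarrow> bool" where
  "forces_constant [] s H \<longleftrightarrow> (\<exists>x. H \<subseteq> {x})"
| "forces_constant ((Birth, p) # w) s H \<longleftrightarrow>
     (\<forall>x. forces_constant w (take p s @ [x, x] @ drop p s) (insert x H))"
| "forces_constant ((Death, p) # w) s H \<longleftrightarrow>
     (s ! Suc p = s ! p \<longrightarrow> forces_constant w (take p s @ drop (p + 2) s) H)"
| "forces_constant ((Cross c, p) # w) s H \<longleftrightarrow>
     forces_constant w (take p s @ [s ! Suc p, s ! p] @ drop (p + 2) s) H"

text \<open>Only right cusps impose equations. A given run makes one of the choices over which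
  \<open>forces_constant\<close> quantifies, and all labels it has met lie in the collected
  set.\<close>

lemma forces_constantD:
  assumes "label_run (\<lambda>x. x) w S" "forces_constant w (S 0) H" "set (S 0) \<subseteq> H"
  shows "\<exists>x. H \<subseteq> {x} \<and> (\<forall>t \<le> length w. set (S t) \<subseteq> {x})"
  using assms
proof (induction w arbitrary: S H)
  case (Cons e w)
  obtain k p where e: "e = (k, p)" by fastforce
  have step: "label_step (\<lambda>x. x) k p (S 0) (S 1)" and run: "label_run (\<lambda>x. x) w (\<lambda>t. S (Suc t))"
    using Cons.prems(1) by (simp_all add: e label_run_Cons)
  have "\<exists>H'. H \<subseteq> H' \<and> forces_constant w (S 1) H' \<and> set (S 1) \<subseteq> H'"
  proof (cases k)
    case Birth
    then obtain x where "S 1 = take p (S 0) @ [x, x] @ drop p (S 0)"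
      using step by (auto simp: label_step_simps)
    then show ?thesis
      using Cons.prems(2,3) by (intro exI[of _ "insert x H"])
        (auto simp: e Birth dest: in_set_takeD in_set_dropD)
  next
    case Death
    then show ?thesis
      using Cons.prems(2,3) step by (intro exI[of _ H])
        (auto simp: e label_step_simps dest: in_set_takeD in_set_dropD)
  next
    case (Cross c)
    then show ?thesis
      using Cons.prems(2,3) step by (intro exI[of _ H])
        (auto simp: e label_step_simps dest: in_set_takeD in_set_dropD)
  qed
  then obtain H' where H': "H \<subseteq> H'" "forces_constant w (S 1) H'" "set (S 1) \<subseteq> H'"
    by blast
  obtain x where x: "H' \<subseteq> {x}" "\<forall>t \<le> length w. set (S (Suc t)) \<subseteq> {x}"
    using Cons.IH[OF run, of H'] H'(2,3) by auto
  have "set (S t) \<subseteq> {x}" if "t \<le> length (e # w)" for t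
    using x H'(1) Cons.prems(3) that by (cases t) auto
  then show ?case
    using x(1) H'(1) by blast
qed auto

lemma component_self: "P \<in> component w P"
  by (simp add: component_def)

lemma component_eq_iff: "component w P = component w Q \<longleftrightarrow> Q \<in> component w P"
proof
  assume "Q \<in> component w P"
  then have PQ: "equivclp (\<lambda>P Q. through w P Q \<or> turn w P Q) P Q"
    by (simp add: component_def)
  then show "component w P = component w Q"
    unfolding component_def using equivclp_trans[OF PQ] equivclp_trans[OF equivclp_sym[OF PQ]] by blast
next
  assume "component w P = component w Q"
  then show "Q \<in> component w P"
    using component_self[of Q w] by simp
qed

lemma component_step: "through w P Q \<or> turn w P Q \<Longrightarrow> component w P = component w Q"
  unfolding component_eq_iff unfolding component_def by (simp add: r_into_equivclp)

text \<open>Labelling every point by its own component is a run, so if all runs are constant there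
  is at most one component.\<close>

lemma knot_wordI:
  assumes "closed_word w" "w \<noteq> []" "forces_constant w [] ({} :: point set set)"
  shows "knot_word w"
proof -
  have "label_run (\<lambda>x. x) w (\<lambda>t. map (\<lambda>j. component w (t, j)) [0..<strands w t])"
    by (rule label_run_of_points[OF assms(1)]) (metis component_step)+
  from forces_constantD[OF this, of "{}"] obtain x
    where x: "\<forall>t \<le> length w. (\<lambda>j. component w (t, j)) ` {0..<strands w t} \<subseteq> {x}"
    using assms(3) by auto
  have "component w (t, j) = x" if "(t, j) \<in> points w" for t j
  proof -
    have "component w (t, j) \<in> (\<lambda>j. component w (t, j)) ` {0..<strands w t}"
      using that by (intro imageI) (simp add: points_def)
    then show ?thesis
      using subsetD[OF x[rule_format]] that unfolding points_def by fast
  qed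
  then have "components w \<subseteq> {x}"
    unfolding components_def image_subset_iff by (metis singletonI surj_pair)
  \<comment> \<open>No other letter fits over zero strands; hence there is a point, and so a
    component.\<close>
  moreover have "fst (w ! 0) = Birth"
    using closed_wordD[OF assms(1), of 0] assms(2) by (cases "fst (w ! 0)") auto
  then have "(1, 0) \<in> points w"
    using assms(2) by (cases w) (auto simp: points_def)
  ultimately have "components w = {x}"
    unfolding components_def by blast
  then show ?thesis
    using assms(1) by (simp add: knot_word_def)
qed

section \<open>Closedness, writhe and connectedness of the chains\<close>

lemma valid_block: "valid (block b @ w) 2 \<longleftrightarrow> valid w 2"
  "valid (smooth_resolution (block b) @ w') 2 \<longleftrightarrow> valid w' 2"
  by (simp_all add: block_def eight_def trefoil_def)

lemma closed_chain: "closed_word (chain bs)" "closed_word (smooth_resolution (chain bs))"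
proof -
  have "valid (blocks bs @ [(Death, 0)]) 2"
    by (induction bs) (simp_all add: valid_block)
  then show "closed_word (chain bs)"
    by (simp add: closed_word_iff_valid chain_def numeral_2_eq_2)
  have "valid (smooth_resolution (blocks bs) @ [(Death, 0)]) 2"
    by (induction bs) (simp_all add: valid_block)
  then show "closed_word (smooth_resolution (chain bs))"
    by (simp add: closed_word_iff_valid chain_def numeral_2_eq_2)
qed

lemma writhes_block:
  "writhes (smooth_resolution (block b) @ w) [d, \<not> d] = (+) (if b then 2 else - 3) ` writhes w [d, \<not> d]"
  by (cases b; cases d) (simp_all add: block_def eight_def trefoil_def UNIV_bool image_image numeral_eq_Suc)

lemma writhe_chain: "writhe (smooth_resolution (chain bs)) = (\<Sum>b \<leftarrow> bs. if b then 2 else - 3)"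
proof (rule writhe_eqI)
  have "writhes (smooth_resolution (blocks bs) @ [(Death, 0)]) [d, \<not> d] = {\<Sum>b \<leftarrow> bs. if b then 2 else - 3}" for d
    by (induction bs) (simp_all add: writhes_block)
  then show "writhes (smooth_resolution (chain bs)) [] = {\<Sum>b \<leftarrow> bs. if b then 2 else - 3}"
    by (simp add: chain_def UNIV_bool)
qed (rule closed_chain)

text \<open>The right cusps of a block identify every label born in it with \<open>x\<close>, since
  the block is tied into a single strand.\<close>

lemma forces_constant_block:
  "forces_constant (block b @ w) [x, x] {x} \<longleftrightarrow> forces_constant w [x, x] {x}"
  by (cases b) (auto simp: block_def eight_def trefoil_def numeral_eq_Suc)

lemma knot_chain: "knot_word (chain bs)"
proof (rule knot_wordI)
  have "forces_constant (blocks bs @ [(Death, 0)]) [x, x] {x}" for x :: "point set"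
    by (induction bs) (auto simp: forces_constant_block)
  then show "forces_constant (chain bs) [] ({} :: point set set)"
    by (simp add: chain_def)
qed (simp_all add: closed_chain, simp add: chain_def)

section \<open>Ruling disks\<close>

definition advance :: "'c piece \<times> nat \<Rightarrow> nat \<Rightarrow> nat list \<Rightarrow> nat list" where
  "advance e m s = (case e of (k, p) \<Rightarrow>
     take p s @ (case k of Birth \<Rightarrow> [m, m] | Death \<Rightarrow> [] | Cross c \<Rightarrow> [s ! Suc p, s ! p]) @
     drop (p + ins k) s)"

text \<open>Every strand is labelled by the left cusp reached by following it to the left.\<close>

fun labels :: "'c sliced \<Rightarrow> nat \<Rightarrow> nat list" where
  "labels R 0 = []"
| "labels R (Suc m) = advance (R ! m) m (labels R m)"

definition letter_ok :: "'c piece \<times> nat \<Rightarrow> nat list \<Rightarrow> bool" where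
  "letter_ok e s = (case e of (k, p) \<Rightarrow>
     (case k of Birth \<Rightarrow> True | Death \<Rightarrow> s ! Suc p = s ! p | Cross c \<Rightarrow> s ! Suc p \<noteq> s ! p))"

definition labels_ok :: "'c sliced \<Rightarrow> bool" where
  "labels_ok R \<longleftrightarrow> (\<forall>m < length R. letter_ok (R ! m) (labels R m))"

lemma length_labels: "closed_word R \<Longrightarrow> m \<le> length R \<Longrightarrow> length (labels R m) = strands R m"
proof (induction m)
  case (Suc m)
  then show ?case
    using closed_wordD[of R m] by (auto simp: advance_def split: prod.splits piece.splits)
qed simp

text \<open>Strands are followed to the left only, so nothing is required of the right cusps: equal
  labels always imply equal components.\<close>

lemma label_birth:
  assumes "closed_word R" "m \<le> length R" "j < strands R m"
  shows "labels R m ! j < m \<and> (\<exists>q. R ! (labels R m ! j) = (Birth, q) \<and>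
    component R (m, j) = component R (Suc (labels R m ! j), q))"
  using assms(2,3)
proof (induction m arbitrary: j)
  case (Suc m)
  obtain k p where kp: "R ! m = (k, p)" by fastforce
  have m: "m < length R" using Suc.prems by simp
  have p: "p + ins k \<le> strands R m"
    using closed_wordD[OF assms(1) m] by (simp add: kp)
  have len: "length (labels R m) = strands R m"
    using length_labels[OF assms(1)] m by simp
  have old: "labels R (Suc m) ! j < Suc m \<and> (\<exists>q. R ! (labels R (Suc m) ! j) = (Birth, q) \<and>
      component R (Suc m, j) = component R (Suc (labels R (Suc m) ! j), q))"
    if "through R (m, i) (Suc m, j)" "i < strands R m" "labels R (Suc m) ! j = labels R m ! i" for i
    using Suc.IH[OF _ that(2)] m that(1,3) component_step[of R "(m, i)" "(Suc m, j)"] by auto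
  consider "j < p" | "p \<le> j" "j < p + outs k" | i where "j = p + outs k + i"
    by (metis le_add_diff_inverse not_less)
  then show ?case
  proof cases
    case 1
    then show ?thesis
      using old[OF through.below[OF m kp 1]] p len by (simp add: kp advance_def nth_append)
  next
    case 2
    show ?thesis
    proof (cases k)
      case Birth
      then have "labels R (Suc m) ! j = m"
        using 2 p len by (cases "j = p") (auto simp: kp advance_def nth_append nth_Cons split: nat.splits)
      moreover have "component R (Suc m, j) = component R (Suc m, p)"
      proof (cases "j = p")
        case False
        then have "j = Suc p" using 2 Birth by simp
        then show ?thesis
          using component_step[of R "(Suc m, p)" "(Suc m, Suc p)"] turn.birth[of m R p] m kp Birth by simp
      qed simp
      ultimately show ?thesis
        using kp Birth by auto
    next
      case Death
      then show ?thesis using 2 by simp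
    next
      case (Cross c)
      then consider "j = p" | "j = Suc p" using 2 by force
      then show ?thesis
      proof cases
        case 1
        then show ?thesis
          using old[of "Suc p"] through.descend[of m R c p] m kp Cross p len
          by (simp add: advance_def nth_append)
      next
        case 2
        then show ?thesis
          using old[of p] through.ascend[of m R c p] m kp Cross p len
          by (simp add: advance_def nth_append)
      qed
    qed
  next
    case 3
    then have i: "p + ins k + i < strands R m"
      using p Suc.prems(2) by (simp add: kp)
    have "labels R (Suc m) ! j = labels R m ! (p + ins k + i)"
      using i len 3 by (cases k) (auto simp: kp advance_def nth_append)
    then show ?thesis
      using old[OF through.above[OF m kp i, folded 3]] i by simp
  qed
qed simp

definition deaths_ok :: "'c sliced \<Rightarrow> bool" where
  "deaths_ok R \<longleftrightarrow> (\<forall>m < length R. \<forall>p. R ! m = (Death, p) \<longrightarrow> labels R m ! Suc p = labels R m ! p)"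

lemma labels_ok_deaths: "labels_ok R \<Longrightarrow> deaths_ok R"
  by (auto simp: labels_ok_def deaths_ok_def letter_ok_def)

lemma label_run_labels:
  assumes "closed_word R" "deaths_ok R"
  shows "label_run (\<lambda>x. x) R (labels R)"
  unfolding label_run_def
proof (intro allI impI)
  fix m assume m: "m < length R"
  obtain k p where kp: "R ! m = (k, p)" by fastforce
  have "p + ins k \<le> length (labels R m)"
    using closed_wordD[OF assms(1) m] length_labels[OF assms(1)] m by (simp add: kp)
  then show "label_step (\<lambda>x. x) (fst (R ! m)) (snd (R ! m)) (labels R m) (labels R (Suc m))"
    using assms(2) m by (cases k) (auto simp: kp label_step_simps advance_def deaths_ok_def)
qed

lemma adjacent_points:
  assumes "closed_word R" "through R P Q \<or> turn R P Q"
  shows "P \<in> points R \<and> Q \<in> points R"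
proof -
  have le: "p + ins k \<le> strands R t" "strands R (Suc t) = strands R t + outs k - ins k"
    if "t < length R" "R ! t = (k, p)" for t k p
    using closed_wordD[OF assms(1) that(1)] that by auto
  show ?thesis
    using assms(2)
  proof
    assume "through R P Q"
    then show ?thesis
      by cases (use le in \<open>fastforce simp: points_def\<close>)+
  next
    assume "turn R P Q"
    then show ?thesis
      by cases (use le in \<open>fastforce simp: points_def\<close>)+
  qed
qed

text \<open>The new direction is that labels are constant on components. It needs right cusps to
  join equal labels, which makes \<open>labels R\<close> a run.\<close>

lemma component_labels:
  assumes "closed_word R" "deaths_ok R" "(m, j) \<in> points R"
  shows "(m', j') \<in> component R (m, j) \<longleftrightarrow> (m', j') \<in> points R \<and> labels R m' ! j' = labels R m ! j"
proof
  assume "(m', j') \<in> component R (m, j)"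
  then have eq: "equivclp (\<lambda>P Q. through R P Q \<or> turn R P Q) (m, j) (m', j')"
    by (simp add: component_def)
  have "((m, j) \<in> points R) = ((m', j') \<in> points R)"
    by (rule equivclp_invariant[OF eq]) (use adjacent_points[OF assms(1)] in blast)
  moreover have "(\<lambda>(m, j). labels R m ! j) (m, j) = (\<lambda>(m, j). labels R m ! j) (m', j')"
    by (rule equivclp_invariant[OF eq])
      (use label_run_through[OF label_run_labels[OF assms(1,2)]] label_run_turn[OF label_run_labels[OF assms(1,2)]]
        in \<open>auto\<close>)
  ultimately show "(m', j') \<in> points R \<and> labels R m' ! j' = labels R m ! j"
    using assms(3) by simp
next
  assume *: "(m', j') \<in> points R \<and> labels R m' ! j' = labels R m ! j"
  then have "component R (m, j) = component R (m', j')"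
    using label_birth[OF assms(1), of m j] label_birth[OF assms(1), of m' j'] assms(3)
    by (auto simp: points_def)
  then show "(m', j') \<in> component R (m, j)"
    by (simp add: component_self)
qed

definition label_deaths :: "'c sliced \<Rightarrow> nat \<Rightarrow> nat \<Rightarrow> nat set" where
  "label_deaths R x m = {u. u < m \<and> (\<exists>q. R ! u = (Death, q) \<and> labels R u ! q = x)}"

lemma split_pair: "p + 2 \<le> length s \<Longrightarrow> s = take p s @ [s ! p, s ! Suc p] @ drop (p + 2) s"
  by (metis Cons_nth_drop_Suc Suc_le_lessD add_2_eq_Suc' append_Cons append_Nil append_take_drop_id less_Suc_eq_le le_SucI less_SucI Suc_lessD)

lemma label_deaths_Suc:
  "label_deaths R x (Suc m) =
     (if \<exists>q. R ! m = (Death, q) \<and> labels R m ! q = x then insert m (label_deaths R x m)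
      else label_deaths R x m)"
  by (auto simp: label_deaths_def less_Suc_eq)

lemma finite_label_deaths [simp]: "finite (label_deaths R x m)"
  by (simp add: label_deaths_def)

text \<open>A left cusp creates two copies of its label, crossings permute them, and a right cusp
  removes two equal ones.\<close>

lemma count_labels:
  assumes "closed_word R" "deaths_ok R" "R ! x = (Birth, q)" "m \<le> length R"
  shows "count_list (labels R m) x + 2 * card (label_deaths R x m) = (if x < m then 2 else 0)"
  using assms(4)
proof (induction m)
  case 0
  then show ?case by (simp add: label_deaths_def)
next
  case (Suc m)
  obtain k p where kp: "R ! m = (k, p)" by fastforce
  have m: "m < length R" using Suc.prems by simp
  define s where "s = labels R m"
  have p: "p + ins k \<le> length s"
    using closed_wordD[OF assms(1) m] length_labels[OF assms(1), of m] m by (simp add: kp s_def)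
  have IH: "count_list s x + 2 * card (label_deaths R x m) = (if x < m then 2 else 0)"
    using Suc by (simp add: s_def)
  show ?case
  proof (cases k)
    case Birth
    have "count_list s x = count_list (take p s) x + count_list (drop p s) x"
      by (metis append_take_drop_id count_list_append)
    then show ?thesis
      using IH by (auto simp: kp Birth advance_def label_deaths_Suc s_def[symmetric] less_Suc_eq)
  next
    case Death
    have "count_list s x = count_list (take p s @ [s ! p, s ! Suc p] @ drop (p + 2) s) x"
      using split_pair[of p s] p Death by simp
    moreover have "s ! Suc p = s ! p"
      using assms(2) m kp Death by (simp add: deaths_ok_def s_def)
    moreover have "x \<noteq> m" using kp Death assms(3) by auto
    moreover have "m \<notin> label_deaths R x m" by (simp add: label_deaths_def)
    ultimately show ?thesis
      using IH by (auto simp: kp Death advance_def label_deaths_Suc s_def[symmetric] less_Suc_eq split: if_splits)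
  next
    case (Cross c)
    have "count_list s x = count_list (take p s @ [s ! p, s ! Suc p] @ drop (p + 2) s) x"
      using split_pair[of p s] p Cross by simp
    moreover have "x \<noteq> m" using kp Cross assms(3) by auto
    ultimately show ?thesis
      using IH by (auto simp: kp Cross advance_def label_deaths_Suc s_def[symmetric] less_Suc_eq split: if_splits)
  qed
qed

text \<open>A right cusp joining different labels would lie on a component with at least three
  cusps. Conversely, if labels agree at right cusps, the component of a label has its left cusp and
  exactly one right cusp.\<close>

lemma ruling_disks_iff:
  assumes "closed_word R"
  shows "(\<forall>C \<in> components R. card (cusps_on R C) = 2 \<and> self_crossings R C = {}) \<longleftrightarrow> labels_ok R"
proof
  assume *: "\<forall>C \<in> components R. card (cusps_on R C) = 2 \<and> self_crossings R C = {}"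
  show "labels_ok R"
    unfolding labels_ok_def
  proof (intro allI impI)
    fix m assume m: "m < length R"
    obtain k p where kp: "R ! m = (k, p)" by fastforce
    have p: "p + ins k \<le> strands R m"
      using closed_wordD[OF assms m] by (simp add: kp)
    show "letter_ok (R ! m) (labels R m)"
    proof (cases k)
      case Birth
      then show ?thesis by (simp add: letter_ok_def kp)
    next
      case Death
      define x where "x = labels R m ! p"
      define y where "y = labels R m ! Suc p"
      define C where "C = component R (m, p)"
      have C: "C \<in> components R"
        using m p Death by (auto simp: components_def C_def points_def)
      have C': "component R (m, Suc p) = C"
        using component_step[of R "(m, p)" "(m, Suc p)"] turn.death[of m R p] m kp Death by (simp add: C_def)
      obtain q where q: "x < m" "R ! x = (Birth, q)" "C = component R (Suc x, q)"
        using label_birth[OF assms, of m p] m p Death by (auto simp: C_def x_def)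
      obtain q' where q': "y < m" "R ! y = (Birth, q')" "C = component R (Suc y, q')"
        using label_birth[OF assms, of m "Suc p"] m p Death C' by (auto simp: y_def)
      have "(Suc x, q) \<in> C" "(Suc y, q') \<in> C" "(m, p) \<in> C"
        using component_self[of "(Suc x, q)" R] component_self[of "(Suc y, q')" R]
          component_self[of "(m, p)" R] q(3) q'(3) by (simp_all add: C_def)
      \<comment> \<open>The right cusp \<open>m\<close> comes after the left cusps \<open>x\<close>
        and \<open>y\<close>, so these are three cusps unless \<open>x = y\<close>.\<close>
      then have "{m, x, y} \<subseteq> cusps_on R C"
        using m kp Death q q' by (auto simp: cusps_on_def)
      moreover have "finite (cusps_on R C)"
        by (simp add: cusps_on_def)
      ultimately have "card {m, x, y} \<le> 2"
        using * C card_mono by metis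
      then have "x = y"
        using q(1) q'(1) by (auto simp: card_insert_if split: if_splits)
      then show ?thesis
        by (simp add: letter_ok_def kp Death x_def y_def)
    next
      case (Cross c)
      have "labels R m ! Suc p \<noteq> labels R m ! p"
      proof
        assume eq: "labels R m ! Suc p = labels R m ! p"
        then have "component R (m, p) = component R (m, Suc p)"
          using label_birth[OF assms, of m p] label_birth[OF assms, of m "Suc p"] m p Cross by auto
        then have "m \<in> self_crossings R (component R (m, p))"
          using m kp Cross component_self[of "(m, p)" R] component_self[of "(m, Suc p)" R]
          by (auto simp: self_crossings_def)
        moreover have "component R (m, p) \<in> components R"
          using m p Cross by (auto simp: components_def points_def)
        ultimately show False
          using * by auto
      qed
      then show ?thesis
        by (simp add: letter_ok_def kp Cross)
    qed
  qed
next
  assume ok: "labels_ok R"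
  note deaths = labels_ok_deaths[OF ok]
  show "\<forall>C \<in> components R. card (cusps_on R C) = 2 \<and> self_crossings R C = {}"
  proof
    fix C assume "C \<in> components R"
    then obtain m j where mj: "(m, j) \<in> points R" "C = component R (m, j)"
      by (auto simp: components_def)
    define x where "x = labels R m ! j"
    have C: "(m', j') \<in> C \<longleftrightarrow> (m', j') \<in> points R \<and> labels R m' ! j' = x" for m' j'
      using component_labels[OF assms deaths mj(1)] by (simp add: mj(2) x_def)
    have x: "x < m" "m \<le> length R" "\<exists>q. R ! x = (Birth, q)"
      using label_birth[OF assms, of m j] mj(1) by (auto simp: points_def x_def)
    have fits: "p + ins k \<le> strands R t" "length (labels R t) = strands R t"
      if "t < length R" "R ! t = (k, p)" for t k p
      using closed_wordD[OF assms] length_labels[OF assms] that by force+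
    have "cusps_on R C = insert x (label_deaths R x (length R))"
    proof (intro equalityI subsetI)
      fix u assume "u \<in> cusps_on R C"
      then show "u \<in> insert x (label_deaths R x (length R))"
        using fits[of u Birth] by (auto simp: cusps_on_def C label_deaths_def advance_def nth_append)
    next
      fix u assume "u \<in> insert x (label_deaths R x (length R))"
      then show "u \<in> cusps_on R C"
        using x fits[of u Birth] fits[of u Death]
        by (fastforce simp: cusps_on_def C label_deaths_def advance_def nth_append points_def)
    qed
    moreover have "x \<notin> label_deaths R x (length R)"
      using x(3) by (auto simp: label_deaths_def)
    moreover have "labels R (length R) = []"
      using length_labels[OF assms, of "length R"] assms by (simp add: closed_word_def)
    \<comment> \<open>No strand is left at the end, so both copies of \<open>x\<close> have been
      removed, by one right cusp.\<close>
    then have "card (label_deaths R x (length R)) = 1"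
      using count_labels[OF assms deaths, of x _ "length R"] x by auto
    ultimately have "card (cusps_on R C) = 2"
      by simp
    moreover have "self_crossings R C = {}"
      using ok by (fastforce simp: self_crossings_def C labels_ok_def letter_ok_def)
    ultimately show "card (cusps_on R C) = 2 \<and> self_crossings R C = {}"
      by simp
  qed
qed

section \<open>Normal rulings as runs\<close>

text \<open>This is membership in \<open>disk_slice\<close>, in terms of labels. A prefix and a
  suffix replace the two quantified end points so that it can be simplified on explicit
  lists.\<close>

definition occupied :: "nat list \<Rightarrow> nat \<Rightarrow> nat \<Rightarrow> bool" where
  "occupied s x j \<longleftrightarrow> x \<in> set (take (Suc j) s) \<and> x \<in> set (drop j s)"

definition unlinked :: "nat list \<Rightarrow> nat \<Rightarrow> nat \<Rightarrow> bool" where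
  "unlinked s x y \<longleftrightarrow>
     (\<forall>j < length s. \<not> (occupied s x j \<and> occupied s y j)) \<or>
     (\<forall>j < length s. occupied s x j \<longrightarrow> occupied s y j) \<or>
     (\<forall>j < length s. occupied s y j \<longrightarrow> occupied s x j)"

lemma disk_slice_labels:
  assumes "closed_word R" "deaths_ok R" "(m, j) \<in> points R"
  shows "disk_slice (component R (m, j)) m =
    {i. i < length (labels R m) \<and> occupied (labels R m) (labels R m ! j) i}"
proof -
  have "length (labels R m) = strands R m" "m \<le> length R"
    using length_labels[OF assms(1)] assms(3) by (auto simp: points_def)
  then have 1: "i \<in> disk_slice (component R (m, j)) m \<longleftrightarrow>
      (\<exists>a b. a < length (labels R m) \<and> b < length (labels R m) \<and> labels R m ! a = labels R m ! j \<and>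
         labels R m ! b = labels R m ! j \<and> a \<le> i \<and> i \<le> b)" for i
    unfolding disk_slice_def component_labels[OF assms] by (auto simp: points_def)
  have 2: "x \<in> set (take (Suc i) s) \<longleftrightarrow> (\<exists>a. a < length s \<and> a \<le> i \<and> s ! a = x)" for i x and s :: "nat list"
    by (auto simp: in_set_conv_nth less_Suc_eq_le)
  have 3: "x \<in> set (drop i s) \<longleftrightarrow> (\<exists>b. b < length s \<and> i \<le> b \<and> s ! b = x)" for i x and s :: "nat list"
  proof
    assume "x \<in> set (drop i s)"
    then obtain k where "k < length s - i" "s ! (i + k) = x"
      by (auto simp: in_set_conv_nth)
    then show "\<exists>b. b < length s \<and> i \<le> b \<and> s ! b = x"
      by (intro exI[of _ "i + k"]) auto
  next
    assume "\<exists>b. b < length s \<and> i \<le> b \<and> s ! b = x"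
    then obtain b where "b < length s" "i \<le> b" "s ! b = x" by blast
    then have "b - i < length (drop i s)" "drop i s ! (b - i) = x" by auto
    then show "x \<in> set (drop i s)" using nth_mem by metis
  qed
  show ?thesis
    unfolding set_eq_iff 1 mem_Collect_eq occupied_def 2 3 by (blast intro: le_less_trans)
qed

text \<open>The counters \<open>t\<close> and \<open>m\<close> are the positions in the front and in its resolution.\<close>

fun ruling_run :: "front \<Rightarrow> nat \<Rightarrow> nat \<Rightarrow> nat list \<Rightarrow> nat set \<Rightarrow> bool" where
  "ruling_run [] t m s S \<longleftrightarrow> True"
| "ruling_run ((Birth, p) # w) t m s S \<longleftrightarrow>
     t \<notin> S \<and> ruling_run w (Suc t) (Suc m) (take p s @ [m, m] @ drop p s) S"
| "ruling_run ((Death, p) # w) t m s S \<longleftrightarrow>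
     t \<notin> S \<and> s ! Suc p = s ! p \<and> ruling_run w (Suc t) (Suc m) (take p s @ drop (p + 2) s) S"
| "ruling_run ((Cross c, p) # w) t m s S \<longleftrightarrow>
     s ! Suc p \<noteq> s ! p \<and>
     (if t \<in> S then unlinked s (s ! p) (s ! Suc p) \<and> ruling_run w (Suc t) m s S
      else ruling_run w (Suc t) (Suc m) (take p s @ [s ! Suc p, s ! p] @ drop (p + 2) s) S)"

definition switch_ok :: "front \<Rightarrow> nat set \<Rightarrow> front \<Rightarrow> nat \<Rightarrow> bool" where
  "switch_ok F S R t \<longleftrightarrow> (let p = snd (F ! t); s = labels R (resolved_slice F S t) in
     s ! Suc p \<noteq> s ! p \<and> unlinked s (s ! p) (s ! Suc p))"

lemma resolve_snoc: "resolve (u @ [e]) S = resolve u S @ (if length u \<in> S then [] else [e])"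
  by (simp add: resolve_def nths_append)

lemma resolve_append: "\<exists>v'. resolve (u @ v) S = resolve u S @ v'"
  by (simp add: resolve_def nths_append)

text \<open>The front is split into the part \<open>u\<close> already read and the rest. The state
  of the run is the list of labels over the slice that the resolution has reached; a letter in
  \<open>S\<close> advances the position in the front only, any other letter advances both.\<close>

lemma ruling_run_iff:
  "ruling_run w (length u) (length (resolve u S)) (labels (resolve (u @ w) S) (length (resolve u S))) S \<longleftrightarrow>
     (\<forall>t. length u \<le> t \<and> t < length (u @ w) \<and> t \<in> S \<longrightarrow>
        fst ((u @ w) ! t) = Cross () \<and> switch_ok (u @ w) S (resolve (u @ w) S) t) \<and>
     (\<forall>m. length (resolve u S) \<le> m \<and> m < length (resolve (u @ w) S) \<longrightarrow>
        letter_ok (resolve (u @ w) S ! m) (labels (resolve (u @ w) S) m))"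
proof (induction w arbitrary: u)
  case Nil
  then show ?case by auto
next
  case (Cons e w)
  obtain k p where e: "e = (k, p)" by fastforce
  define F where "F = u @ e # w"
  define R where "R = resolve F S"
  define T where "T t \<longleftrightarrow> fst (F ! t) = Cross () \<and> switch_ok F S R t" for t
  define M where "M m \<longleftrightarrow> letter_ok (R ! m) (labels R m)" for m
  define n where "n = length (resolve u S)"
  have F: "F = (u @ [e]) @ w" by (simp add: F_def)
  have at: "F ! length u = (k, p)" "length u < length F" by (simp_all add: F_def e)
  have IH: "ruling_run w (Suc (length u)) (length (resolve (u @ [e]) S)) (labels R (length (resolve (u @ [e]) S))) S \<longleftrightarrow>
      (\<forall>t. Suc (length u) \<le> t \<and> t < length F \<and> t \<in> S \<longrightarrow> T t) \<and>
      (\<forall>m. length (resolve (u @ [e]) S) \<le> m \<and> m < length R \<longrightarrow> M m)"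
    using Cons.IH[of "u @ [e]"] by (simp add: R_def F_def T_def M_def)
  have split: "(\<forall>t. a \<le> t \<and> t < b \<and> P t \<longrightarrow> Q t) \<longleftrightarrow>
      (P a \<longrightarrow> Q a) \<and> (\<forall>t. Suc a \<le> t \<and> t < b \<and> P t \<longrightarrow> Q t)" if "a < b" for a b :: nat and P Q
    using that by (metis Suc_leD Suc_leI le_neq_implies_less order_refl)
  have goal: "ruling_run (e # w) (length u) n (labels R n) S \<longleftrightarrow>
      (length u \<in> S \<longrightarrow> T (length u)) \<and> (\<forall>t. Suc (length u) \<le> t \<and> t < length F \<and> t \<in> S \<longrightarrow> T t) \<and>
      (\<forall>m. n \<le> m \<and> m < length R \<longrightarrow> M m)"
  proof (cases "length u \<in> S")
    case True
    then have "resolve (u @ [e]) S = resolve u S" by (simp add: resolve_snoc)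
    moreover have "resolved_slice F S (length u) = n"
      by (simp add: resolved_slice_def F_def n_def)
    ultimately show ?thesis
      using IH True at by (cases k) (auto simp: e T_def switch_ok_def n_def Let_def)
  next
    case False
    then have snoc: "resolve (u @ [e]) S = resolve u S @ [e]" by (simp add: resolve_snoc)
    obtain v where v: "R = resolve (u @ [e]) S @ v"
      using resolve_append[of "u @ [e]" w S] by (auto simp: R_def F)
    then have n: "R ! n = (k, p)" "n < length R"
      unfolding snoc by (simp_all add: n_def nth_append e)
    have "(\<forall>m. n \<le> m \<and> m < length R \<longrightarrow> M m) \<longleftrightarrow> M n \<and> (\<forall>m. Suc n \<le> m \<and> m < length R \<longrightarrow> M m)"
      using split[OF n(2), of "\<lambda>_. True" M] by simp
    then show ?thesis
      using IH False n snoc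
      by (cases k) (auto simp: e n_def[symmetric] M_def letter_ok_def advance_def)
  qed
  show ?case
    using goal split[OF at(2), of "\<lambda>t. t \<in> S" T]
    by (simp add: R_def F_def T_def M_def n_def)
qed

text \<open>A crossing has as many strands on its right as on its left, so deleting it leaves all
  later counts unchanged.\<close>

lemma valid_nths:
  "valid w n \<Longrightarrow> \<forall>t < length w. t \<notin> B \<longrightarrow> (\<exists>c. fst (w ! t) = Cross c) \<Longrightarrow> valid (nths w B) n"
proof (induction w arbitrary: n B)
  case (Cons e w)
  obtain k p where e: "e = (k, p)" by fastforce
  have "valid (nths w {j. Suc j \<in> B}) (n + outs k - ins k)"
  proof (rule Cons.IH)
    show "valid w (n + outs k - ins k)" using Cons.prems(1) by (simp add: e)
    show "\<forall>t < length w. t \<notin> {j. Suc j \<in> B} \<longrightarrow> (\<exists>c. fst (w ! t) = Cross c)"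
      using Cons.prems(2) by auto
  qed
  moreover have "0 \<notin> B \<Longrightarrow> ins k = outs k"
    using Cons.prems(2) by (auto simp: e)
  ultimately show ?case
    using Cons.prems(1) by (auto simp: nths_Cons e)
qed simp

lemma closed_resolve:
  assumes "closed_word F" "S \<subseteq> crossings F"
  shows "closed_word (resolve F S)"
  using assms unfolding closed_word_iff_valid resolve_def
  by (intro valid_nths) (auto simp: crossings_def)

lemma strands_resolved:
  assumes "S \<subseteq> crossings F" "t \<le> length F" "closed_word F"
  shows "strands (resolve F S) (resolved_slice F S t) = strands F t"
  using assms(2)
proof (induction t)
  case 0
  then show ?case by (simp add: resolved_slice_def resolve_def)
next
  case (Suc t)
  then have t: "t < length F" by simp
  then have tk: "take (Suc t) F = take t F @ [F ! t]" by (rule take_Suc_conv_app_nth)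
  obtain v where v: "resolve F S = resolve (take (Suc t) F) S @ v"
    using resolve_append[of "take (Suc t) F" "drop (Suc t) F" S] by auto
  show ?case
  proof (cases "t \<in> S")
    case True
    then have "resolved_slice F S (Suc t) = resolved_slice F S t"
      unfolding resolved_slice_def tk using t by (simp add: resolve_snoc)
    moreover have "fst (F ! t) = Cross ()"
      using True assms(1) by (auto simp: crossings_def)
    ultimately show ?thesis using Suc by simp
  next
    case False
    then have "resolve (take (Suc t) F) S = resolve (take t F) S @ [F ! t]"
      unfolding tk using t by (simp add: resolve_snoc)
    then have "resolved_slice F S (Suc t) = Suc (resolved_slice F S t)"
      "resolve F S ! resolved_slice F S t = F ! t"
      by (simp_all add: resolved_slice_def v nth_append)
    then show ?thesis using Suc by simp
  qed
qed

text \<open>A run rejects cusps in \<open>S\<close> by itself but reads \<open>S\<close> only at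
  positions of the word, so what remains is the bound by its length.\<close>

lemma normal_ruling_iff:
  assumes "closed_word F"
  shows "normal_ruling F S \<longleftrightarrow> S \<subseteq> {..<length F} \<and> ruling_run F 0 0 [] S"
proof -
  define R where "R = resolve F S"
  have ruling_run: "ruling_run F 0 0 [] S \<longleftrightarrow>
      (\<forall>t < length F. t \<in> S \<longrightarrow> fst (F ! t) = Cross () \<and> switch_ok F S R t) \<and> labels_ok R"
    using ruling_run_iff[of F "[]" S] by (auto simp: R_def labels_ok_def resolve_def)
  have switch: "(let s = resolved_slice F S t; p = snd (F ! t);
             A = component R (s, p); B = component R (s, Suc p);
             I = disk_slice A s; J = disk_slice B s
         in A \<noteq> B \<and> (I \<inter> J = {} \<or> I \<subseteq> J \<or> J \<subseteq> I)) \<longleftrightarrow> switch_ok F S R t"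
    if S: "S \<subseteq> crossings F" and ok: "labels_ok R" and t: "t \<in> S" for t
  proof -
    have t': "t < length F" "fst (F ! t) = Cross ()"
      using S t by (auto simp: crossings_def)
    define m where "m = resolved_slice F S t"
    define p where "p = snd (F ! t)"
    have R: "closed_word R" unfolding R_def by (rule closed_resolve[OF assms S])
    obtain v where "R = resolve (take t F) S @ v"
      using resolve_append[of "take t F" "drop t F" S] by (auto simp: R_def)
    then have m: "m \<le> length R"
      by (simp add: m_def resolved_slice_def)
    have "p + 2 \<le> strands R m"
      using closed_wordD[OF assms t'(1)] strands_resolved[OF S _ assms, of t] t'
      by (simp add: R_def m_def p_def)
    then have pts: "(m, p) \<in> points R" "(m, Suc p) \<in> points R" and len: "p + 2 \<le> length (labels R m)"
      using m length_labels[OF R m] by (auto simp: points_def)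
    note deaths = labels_ok_deaths[OF ok]
    have "component R (m, p) = component R (m, Suc p) \<longleftrightarrow> labels R m ! Suc p = labels R m ! p"
      unfolding component_eq_iff component_labels[OF R deaths pts(1)] using pts by simp
    then show ?thesis
      unfolding Let_def switch_ok_def m_def[symmetric] p_def[symmetric]
        disk_slice_labels[OF R deaths pts(1)] disk_slice_labels[OF R deaths pts(2)] unlinked_def
      by auto
  qed
  show ?thesis
  proof (cases "S \<subseteq> crossings F")
    case True
    then have *: "S \<subseteq> {..<length F}" "\<forall>t < length F. t \<in> S \<longrightarrow> fst (F ! t) = Cross ()"
      by (auto simp: crossings_def)
    have "normal_ruling F S \<longleftrightarrow> labels_ok R \<and> (\<forall>t \<in> S. switch_ok F S R t)"
    proof (cases "labels_ok R")
      case ok: True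
      note switch' = switch[OF True ok, unfolded Let_def]
      show ?thesis
        unfolding normal_ruling_def Let_def R_def[symmetric]
          ruling_disks_iff[OF closed_resolve[OF assms True], folded R_def]
        using True ok by (simp only: switch' simp_thms cong: ball_cong)
    next
      case False
      then show ?thesis
        unfolding normal_ruling_def Let_def R_def[symmetric]
          ruling_disks_iff[OF closed_resolve[OF assms True], folded R_def] by (simp only: simp_thms)
    qed
    then show ?thesis
      using ruling_run * by auto
  next
    case False
    then show ?thesis
      using ruling_run by (auto simp: normal_ruling_def crossings_def)
  qed
qed

section \<open>The unique ruling of a chain\<close>

definition switches :: "bool \<Rightarrow> nat set" where
  "switches b = (if b then {2, 6, 8, 12} else {1, 3, 4})"

text \<open>Every other choice sooner or later crosses equal labels, joins different ones at a right
  cusp, or switches between linked disks. The bound \<open>x < m\<close> keeps labels born in the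
  block different from \<open>x\<close>; it persists, so blocks can be treated one after
  another.\<close>

lemma ruling_run_block:
  assumes "x < m"
  shows "\<exists>m' > x. \<forall>w S. ruling_run (block b @ w) t m [x, x] S \<longleftrightarrow>
     (\<forall>i < length (block b). t + i \<in> S \<longleftrightarrow> i \<in> switches b) \<and> ruling_run w (t + length (block b)) m' [x, x] S"
proof -
  \<comment> \<open>Four of the 14 letters of \<open>eight\<close> are switches and disappear from
    the resolution, hence \<open>m + 10\<close>; for \<open>trefoil\<close>, three of 7 do, hence
    \<open>m + 4\<close>.\<close>
  have "ruling_run (eight @ w) t m [x, x] S \<longleftrightarrow>
      (\<forall>i < 14. t + i \<in> S \<longleftrightarrow> i \<in> {2, 6, 8, 12}) \<and> ruling_run w (t + 14) (m + 10) [x, x] S" for w S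
    using assms
    by (simp add: eight_def numeral_eq_Suc unlinked_def occupied_def All_less_Suc) blast
  moreover have "ruling_run (trefoil @ w) t m [x, x] S \<longleftrightarrow>
      (\<forall>i < 7. t + i \<in> S \<longleftrightarrow> i \<in> {1, 3, 4}) \<and> ruling_run w (t + 7) (m + 4) [x, x] S" for w S
    using assms
    by (simp add: trefoil_def numeral_eq_Suc unlinked_def occupied_def All_less_Suc) blast
  moreover have "length eight = 14" "length trefoil = 7"
    by (simp_all add: eight_def trefoil_def)
  ultimately show ?thesis
    using assms by (intro exI[of _ "if b then m + 10 else m + 4"]) (simp add: block_def switches_def)
qed

lemma ruling_run_blocks:
  "x < m \<Longrightarrow> \<exists>B. \<forall>S. ruling_run (blocks bs @ [(Death, 0)]) t m [x, x] S \<longleftrightarrow>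
     (\<forall>i < Suc (length (blocks bs)). t + i \<in> S \<longleftrightarrow> i \<in> B)"
proof (induction bs arbitrary: t m)
  case Nil
  show ?case by (rule exI[of _ "{}"]) simp
next
  case (Cons b bs)
  let ?n = "length (block b)"
  obtain m' where m': "x < m'" "\<And>w S. ruling_run (block b @ w) t m [x, x] S \<longleftrightarrow>
      (\<forall>i < ?n. t + i \<in> S \<longleftrightarrow> i \<in> switches b) \<and> ruling_run w (t + ?n) m' [x, x] S"
    using ruling_run_block[OF Cons.prems] by metis
  obtain B where B: "\<And>S. ruling_run (blocks bs @ [(Death, 0)]) (t + ?n) m' [x, x] S \<longleftrightarrow>
      (\<forall>i < Suc (length (blocks bs)). t + ?n + i \<in> S \<longleftrightarrow> i \<in> B)"
    using Cons.IH[OF m'(1)] by metis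
  define B' where "B' = {i. if i < ?n then i \<in> switches b else i - ?n \<in> B}"
  have "(\<forall>i < ?n + k. Q i) \<longleftrightarrow> (\<forall>i < ?n. Q i) \<and> (\<forall>i < k. Q (?n + i))" for k Q
  proof safe
    fix i assume "\<forall>i < ?n. Q i" "\<forall>i < k. Q (?n + i)" "i < ?n + k"
    then show "Q i" by (cases "i < ?n") (auto dest: spec[of _ "i - ?n"])
  qed auto
  from this[of "Suc (length (blocks bs))"]
  have "ruling_run (blocks (b # bs) @ [(Death, 0)]) t m [x, x] S \<longleftrightarrow>
      (\<forall>i < Suc (length (blocks (b # bs))). t + i \<in> S \<longleftrightarrow> i \<in> B')" for S
    using m'(2)[of "blocks bs @ [(Death, 0)]" S] B[of S] by (simp add: B'_def add.assoc)
  then show ?case by blast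
qed

lemma unique_ruling_chain: "\<exists>!S. normal_ruling (chain bs) S"
proof -
  let ?n = "Suc (length (blocks bs))"
  obtain B where B: "\<And>S. ruling_run (blocks bs @ [(Death, 0)]) 1 1 [0, 0] S \<longleftrightarrow>
      (\<forall>i < ?n. 1 + i \<in> S \<longleftrightarrow> i \<in> B)"
    using ruling_run_blocks[of 0 1 bs 1] by auto
  \<comment> \<open>The shift by one accounts for the outer left cusp, which occupies position
    \<open>0\<close> of the chain.\<close>
  define T where "T = {i. i < Suc ?n \<and> i \<noteq> 0 \<and> i - 1 \<in> B}"
  have "normal_ruling (chain bs) S \<longleftrightarrow> S = T" for S
  proof -
    have "normal_ruling (chain bs) S \<longleftrightarrow>
        S \<subseteq> {..<Suc ?n} \<and> 0 \<notin> S \<and> (\<forall>i < ?n. Suc i \<in> S \<longleftrightarrow> i \<in> B)"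
      using B[of S] by (simp add: normal_ruling_iff[OF closed_chain(1)]) (simp add: chain_def)
    also have "\<dots> \<longleftrightarrow> S = T"
    proof safe
      fix i assume "S \<subseteq> {..<Suc ?n}" "0 \<notin> S" "\<forall>i < ?n. Suc i \<in> S \<longleftrightarrow> i \<in> B" "i \<in> S"
      then show "i \<in> T" by (cases i) (auto simp: T_def)
    next
      fix i assume "S \<subseteq> {..<Suc ?n}" "0 \<notin> S" "\<forall>i < ?n. Suc i \<in> S \<longleftrightarrow> i \<in> B" "i \<in> T"
      then show "i \<in> S" by (cases i) (auto simp: T_def)
    qed (auto simp: T_def)
    finally show ?thesis .
  qed
  then show ?thesis by simp
qed

lemma impostor_chain: "bs \<noteq> [] \<Longrightarrow> impostor (chain bs)"
  unfolding impostor_def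
  using knot_chain chain_not_unknot unique_ruling_chain chain_not_decreasing by blast

lemma front_isotopic_length: "front_isotopic F G \<Longrightarrow> length F = length G"
  unfolding front_isotopic_def
  by (erule equivclp_invariant) (auto simp: in_context_def elim!: exchange.cases)

section \<open>The family\<close>

text \<open>The five repeated blocks have total writhe \<open>3 * 2 - 2 * 3 = 0\<close>, so the
  first block alone determines the writhe.\<close>

definition family :: "nat \<Rightarrow> front" where
  "family n = chain (True # concat (replicate n [True, True, True, False, False]))"

lemma family_in: "family n \<in> {F. impostor F \<and> writhe (smooth_resolution F) = 2}"
proof -
  have "(\<Sum>b \<leftarrow> concat (replicate n [True, True, True, False, False]). if b then 2 else - 3 :: int) = 0"
    by (induction n) simp_all
  then show ?thesis
    by (simp add: family_def impostor_chain writhe_chain)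
qed

text \<open>One \<open>eight\<close> and the two outer cusps give \<open>14 + 2\<close> letters,
  each repetition \<open>3 * 14 + 2 * 7\<close>.\<close>

lemma length_family: "length (family n) = 16 + 56 * n"
proof -
  have "length (blocks (concat (replicate n [True, True, True, False, False]))) = 56 * n"
    by (induction n) (simp_all add: block_def eight_def trefoil_def)
  then show ?thesis
    by (simp add: family_def chain_def block_def eight_def)
qed

theorem theorem1p14:
  shows "infinite ({F. impostor F \<and> writhe (smooth_resolution F) = 2} //
           {(F, G). front_isotopic F G})"
proof
  let ?r = "{(F, G). front_isotopic F G}"
  let ?A = "{F. impostor F \<and> writhe (smooth_resolution F) = 2}"
  assume "finite (?A // ?r)"
  moreover have "(\<lambda>n. ?r `` {family n}) ` UNIV \<subseteq> ?A // ?r"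
    by (intro image_subsetI quotientI family_in)
  ultimately have "finite (range (\<lambda>n. ?r `` {family n}))"
    by (rule finite_subset[rotated])
  moreover have "inj (\<lambda>n. ?r `` {family n})"
  proof (rule injI)
    fix m n assume eq: "?r `` {family m} = ?r `` {family n}"
    have "family n \<in> ?r `` {family n}"
      by (simp add: front_isotopic_def)
    then have "family n \<in> ?r `` {family m}"
      unfolding eq .
    then have "front_isotopic (family m) (family n)"
      by simp
    then show "m = n"
      using front_isotopic_length length_family by fastforce
  qed
  ultimately show False
    using finite_imageD infinite_UNIV_nat by blast
qed

end
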